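(* Let $\mathbb{H}^2$ (curvature $-1$) be represented by the Beltrami–Klein model on the open unit disk $D$, and let $K\subset D$ be a compact convex set with nonempty interior. Then the hyperbolic perimeter of $K$ is $$\mathcal{P}=\int_0^{2\pi}h(\varphi)\,d\varphi,\qquad h(\varphi)=\cot\psi_1(\varphi),$$ where $h(\varphi)$ is the signed coordinate $t$ of the point where the right-hand support line of $K$ through $R(\varphi)$ (the line through $R(\varphi)$ at angle $\psi_1(\varphi)$) meets the $\varphi$-normal $\{t\,e(\varphi)\}$.
   Context: Beltrami–Klein model: $D$ with the Hilbert metric $h(P,Q)=\frac12\log\!\left(\frac{|AQ|}{|AP|}\frac{|BP|}{|BQ|}\right)$, where $A,B$ are the points where the Euclidean line $PQ$ meets the unit circle, in order $A,P,Q,B$; this is the hyperbolic plane of curvature $-1$ and the perimeter is the $h$-length of $\partial K$. For $\varphi\in[0,2\pi)$: $R(\varphi)=(\cos\varphi,\sin\varphi)$, $e(\varphi)=(-\sin\varphi,\cos\varphi)$, the $\varphi$-normal is the line $\{t\,e(\varphi):t\in\mathbb{R}\}$. For $X\in D$ let $\psi_X(\varphi)\in(0,\pi)$ be the counterclockwise angle from $e(\varphi)$ to the direction of $X-R(\varphi)$; $\psi_1(\varphi)=\min_{X\in K}\psi_X(\varphi)$. The line through $R(\varphi)$ at counterclockwise angle $\psi$ from $e(\varphi)$ meets the $\varphi$-normal at $t=\cot\psi$. *)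

theory Defs
  imports "HOL-Analysis.Analysis"
begin

definition kleinD :: "complex set" where
  "kleinD = ball 0 1"

definition chordA :: "complex \<Rightarrow> complex \<Rightarrow> complex" where
  "chordA P Q = P + of_real (THE s. s < 0 \<and> cmod (P + of_real s * (Q - P)) = 1) * (Q - P)"

definition chordB :: "complex \<Rightarrow> complex \<Rightarrow> complex" where
  "chordB P Q = P + of_real (THE s. s > 1 \<and> cmod (P + of_real s * (Q - P)) = 1) * (Q - P)"

definition hdist :: "complex \<Rightarrow> complex \<Rightarrow> real" where
  "hdist P Q = (if P = Q then 0 else
     (1/2) * ln ((dist (chordA P Q) Q / dist (chordA P Q) P) *
                 (dist (chordB P Q) P / dist (chordB P Q) Q)))"

definition hlength :: "(real \<Rightarrow> complex) \<Rightarrow> real" where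
  "hlength \<gamma> = Sup {(\<Sum>i<n. hdist (\<gamma> (t i)) (\<gamma> (t (Suc i)))) | n t.
       t 0 = 0 \<and> t n = 1 \<and> (\<forall>i<n. t i \<le> t (Suc i))}"

definition Rpt :: "real \<Rightarrow> complex" where
  "Rpt \<phi> = Complex (cos \<phi>) (sin \<phi>)"

definition evec :: "real \<Rightarrow> complex" where
  "evec \<phi> = Complex (- sin \<phi>) (cos \<phi>)"

definition psiX :: "complex \<Rightarrow> real \<Rightarrow> real" where
  "psiX X \<phi> = (THE \<psi>. 0 < \<psi> \<and> \<psi> < pi \<and>
      X - Rpt \<phi> = of_real (cmod (X - Rpt \<phi>)) * (cis \<psi> * evec \<phi>))"

definition psi1 :: "complex set \<Rightarrow> real \<Rightarrow> real" where
  "psi1 K \<phi> = Inf ((\<lambda>X. psiX X \<phi>) ` K)"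

definition supp_h :: "complex set \<Rightarrow> real \<Rightarrow> real" where
  "supp_h K \<phi> = cot (psi1 K \<phi>)"

end

theory Submission
  imports Defs
begin

text \<open>For fixed \<open>X\<close> the function \<open>\<phi> \<mapsto> cot (psiX X \<phi>)\<close> is the derivative of
  \<open>- ln (1 - X \<bullet> Rpt \<phi>)\<close>. Integrating over the two arcs cut off by the chord through \<open>P\<close> and \<open>Q\<close>
  gives the Crofton formula that \<open>4 * hdist P Q\<close> is the integral of
  \<open>\<bar>cot (psiX P \<phi>) - cot (psiX Q \<phi>)\<bar>\<close>. Hence the length of an inscribed polygon is the
  integral over \<open>\<phi>\<close> of a quarter of the variation of \<open>cot (psiX _ \<phi>)\<close> along its vertices. Along the
  frontier this function takes each value strictly between its minimum \<open>m \<phi>\<close> and its maximum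
  \<open>M \<phi>\<close> on \<open>K\<close> at most twice, because a line through an interior point meets the frontier at most
  twice; so its variation is \<open>2 * (M \<phi> - m \<phi>)\<close> and the length is half the integral of \<open>M - m\<close>.
  Finally the integrals of \<open>M\<close> and \<open>- m\<close> agree: a right-hand support line through \<open>Rpt \<phi>\<close> is a
  left-hand support line through its other end.\<close>

subsection \<open>The coordinate on the normal\<close>

text \<open>\<open>chord_num X \<phi>\<close> and \<open>chord_den X \<phi>\<close> are the components of \<open>X - Rpt \<phi>\<close> along \<open>evec \<phi>\<close> and
  \<open>- Rpt \<phi>\<close>, so that \<open>ncoord X \<phi> = cot (psiX X \<phi>)\<close>.\<close>

definition chord_num :: "complex \<Rightarrow> real \<Rightarrow> real" where
  "chord_num X \<phi> = Im X * cos \<phi> - Re X * sin \<phi>"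

definition chord_den :: "complex \<Rightarrow> real \<Rightarrow> real" where
  "chord_den X \<phi> = 1 - (Re X * cos \<phi> + Im X * sin \<phi>)"

definition ncoord :: "complex \<Rightarrow> real \<Rightarrow> real" where
  "ncoord X \<phi> = chord_num X \<phi> / chord_den X \<phi>"

lemma chord_num_eq_Im: "chord_num X \<phi> = Im (X * cis (- \<phi>))"
  by (simp add: chord_num_def algebra_simps)

lemma chord_den_eq_Re: "chord_den X \<phi> = 1 - Re (X * cis (- \<phi>))"
  by (simp add: chord_den_def algebra_simps)

lemma abs_chord_num_le: "\<bar>chord_num X \<phi>\<bar> \<le> cmod X"
  using abs_Im_le_cmod[of "X * cis (- \<phi>)"] by (simp add: chord_num_eq_Im norm_mult)

lemma abs_chord_den_le: "\<bar>chord_den X \<phi> - 1\<bar> \<le> cmod X"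
  using abs_Re_le_cmod[of "X * cis (- \<phi>)"] by (simp add: chord_den_eq_Re norm_mult)

lemma chord_den_ge: "1 - cmod X \<le> chord_den X \<phi>"
  using abs_chord_den_le[of X \<phi>] by linarith

lemma chord_den_pos: "cmod X < 1 \<Longrightarrow> 0 < chord_den X \<phi>"
  using chord_den_ge[of X \<phi>] by linarith

lemma chord_num_diff: "chord_num (X - Y) \<phi> = chord_num X \<phi> - chord_num Y \<phi>"
  by (simp add: chord_num_def algebra_simps)

lemma chord_den_diff: "chord_den (X - Y) \<phi> - 1 = chord_den X \<phi> - chord_den Y \<phi>"
  by (simp add: chord_den_def algebra_simps)

lemma DERIV_chord_num [derivative_intros]:
  "(chord_num X has_real_derivative (chord_den X \<phi> - 1)) (at \<phi> within S)"
  unfolding chord_num_def[abs_def] chord_den_def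
  by (auto intro!: derivative_eq_intros)

lemma DERIV_chord_den [derivative_intros]:
  "(chord_den X has_real_derivative (- chord_num X \<phi>)) (at \<phi> within S)"
  unfolding chord_num_def chord_den_def[abs_def]
  by (auto intro!: derivative_eq_intros)

lemma ncoord_2pi [simp]: "ncoord X (\<phi> + 2 * pi) = ncoord X \<phi>"
  by (simp add: ncoord_def chord_num_def chord_den_def)

text \<open>The derivative of \<open>chord_den X\<close> is \<open>- chord_num X\<close>. This
  primitive reduces Crofton's integral to logarithms at the two ends of a chord.\<close>

lemma ncoord_eq_log_derivative:
  assumes "cmod X < 1"
  shows "((\<lambda>\<phi>. - ln (chord_den X \<phi>)) has_real_derivative ncoord X \<phi>) (at \<phi> within S)"
  using chord_den_pos[OF assms, of \<phi>]
  by (auto intro!: derivative_eq_intros simp: ncoord_def)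

lemma ncoord_continuous: 
  assumes "cmod X < 1"
  shows "continuous_on S (ncoord X)"
proof -
  have "chord_den X \<phi> \<noteq> 0" for \<phi>
    using chord_den_pos[OF assms, of \<phi>] by simp
  then show ?thesis
    unfolding ncoord_def[abs_def]
    by (intro continuous_on_divide DERIV_continuous_on[OF DERIV_chord_num]
        DERIV_continuous_on[OF DERIV_chord_den]) auto
qed

text \<open>Multiplying by the positive denominator gives a condition affine in \<open>X\<close>, so
  each level set of the coordinate lies on a line through \<open>Rpt \<phi>\<close>.\<close>

lemma ncoord_le_iff:
  assumes "cmod X < 1"
  shows "ncoord X \<phi> \<le> v \<longleftrightarrow> chord_num X \<phi> - v * chord_den X \<phi> \<le> 0"
    and "v \<le> ncoord X \<phi> \<longleftrightarrow> 0 \<le> chord_num X \<phi> - v * chord_den X \<phi>"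
  using chord_den_pos[OF assms, of \<phi>] by (auto simp: ncoord_def field_simps)

text \<open>Over a common denominator, which is at least \<open>(1 - r)\<^sup>2\<close>, the
  constant 3 arises as 2 + 1: denominators are at most 2 and numerators at most 1 in
  modulus.\<close>

lemma ncoord_lipschitz_point:
  assumes "cmod X \<le> r" "cmod Y \<le> r" "r < 1"
  shows "\<bar>ncoord X \<phi> - ncoord Y \<phi>\<bar> \<le> 3 / (1 - r)\<^sup>2 * cmod (X - Y)"
proof -
  have d: "1 - r \<le> chord_den X \<phi>" "1 - r \<le> chord_den Y \<phi>"
    using chord_den_ge[of X \<phi>] chord_den_ge[of Y \<phi>] assms by linarith+
  have "(1 - r)\<^sup>2 \<le> chord_den X \<phi> * chord_den Y \<phi>"
    unfolding power2_eq_square using d assms by (intro mult_mono) auto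
  moreover have "(1 - r)\<^sup>2 > 0"
    using assms by simp
  moreover have "\<bar>chord_num (X - Y) \<phi> * chord_den Y \<phi> + chord_num Y \<phi> * (chord_den Y \<phi> - chord_den X \<phi>)\<bar>
      \<le> 3 * cmod (X - Y)"
  proof -
    have "\<bar>chord_num (X - Y) \<phi> * chord_den Y \<phi>\<bar> \<le> cmod (X - Y) * 2"
      unfolding abs_mult using abs_chord_num_le[of "X - Y" \<phi>] abs_chord_den_le[of Y \<phi>] assms
      by (intro mult_mono) auto
    moreover have "\<bar>chord_den Y \<phi> - chord_den X \<phi>\<bar> \<le> cmod (X - Y)"
      using abs_chord_den_le[of "X - Y" \<phi>] unfolding chord_den_diff by linarith
    then have "\<bar>chord_num Y \<phi> * (chord_den Y \<phi> - chord_den X \<phi>)\<bar> \<le> 1 * cmod (X - Y)"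
      unfolding abs_mult using abs_chord_num_le[of Y \<phi>] assms
      by (intro mult_mono) auto
    ultimately show ?thesis by linarith
  qed
  ultimately have "\<bar>chord_num (X - Y) \<phi> * chord_den Y \<phi> + chord_num Y \<phi> * (chord_den Y \<phi> - chord_den X \<phi>)\<bar>
      / (chord_den X \<phi> * chord_den Y \<phi>) \<le> 3 * cmod (X - Y) / (1 - r)\<^sup>2"
    by (intro frac_le) auto
  moreover have "ncoord X \<phi> - ncoord Y \<phi> =
      (chord_num (X - Y) \<phi> * chord_den Y \<phi> + chord_num Y \<phi> * (chord_den Y \<phi> - chord_den X \<phi>))
      / (chord_den X \<phi> * chord_den Y \<phi>)"
    using d assms by (simp add: ncoord_def chord_num_diff field_simps)
  ultimately show ?thesis
    using d assms by (simp add: abs_mult)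
qed

text \<open>Mean value bound: \<open>D\<close> is the derivative by the quotient rule, and its
  numerator is at most 1 * 2 + 1 in modulus.\<close>

lemma ncoord_lipschitz_angle:
  assumes "cmod X \<le> r" "r < 1"
  shows "\<bar>ncoord X a - ncoord X b\<bar> \<le> 3 / (1 - r)\<^sup>2 * \<bar>a - b\<bar>"
proof -
  define D where "D \<phi> = ((chord_den X \<phi> - 1) * chord_den X \<phi> + (chord_num X \<phi>)\<^sup>2) / (chord_den X \<phi>)\<^sup>2" for \<phi>
  have pos: "1 - r \<le> chord_den X \<phi>" "0 < chord_den X \<phi>" for \<phi>
    using chord_den_ge[of X \<phi>] assms by linarith+
  have "(ncoord X has_field_derivative D \<phi>) (at \<phi> within UNIV)" for \<phi>
    unfolding ncoord_def[abs_def] D_def using pos(2)[of \<phi>]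
    by (auto intro!: derivative_eq_intros simp: power2_eq_square)
  moreover have "norm (D \<phi>) \<le> 3 / (1 - r)\<^sup>2" for \<phi>
  proof -
    have "\<bar>(chord_den X \<phi> - 1) * chord_den X \<phi>\<bar> \<le> 1 * 2"
      unfolding abs_mult using abs_chord_den_le[of X \<phi>] assms by (intro mult_mono) auto
    moreover have "(chord_num X \<phi>)\<^sup>2 \<le> 1"
      using abs_chord_num_le[of X \<phi>] assms by (simp add: abs_square_le_1)
    ultimately have "\<bar>(chord_den X \<phi> - 1) * chord_den X \<phi> + (chord_num X \<phi>)\<^sup>2\<bar> \<le> 3"
      using zero_le_power2[of "chord_num X \<phi>"] by linarith
    moreover have "(1 - r)\<^sup>2 \<le> (chord_den X \<phi>)\<^sup>2"
      using pos assms by (intro power_mono) auto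
    ultimately show ?thesis
      unfolding D_def using assms by (simp add: frac_le)
  qed
  ultimately have "norm (ncoord X a - ncoord X b) \<le> 3 / (1 - r)\<^sup>2 * norm (a - b)"
    by (intro field_differentiable_bound[of UNIV]) auto
  then show ?thesis by simp
qed

text \<open>Rotation by \<open>cis (- \<phi>)\<close> moves \<open>Rpt \<phi>\<close> to 1 and
  \<open>evec \<phi>\<close> to \<open>\<i>\<close>. The defining equation then makes
  \<open>Im Z\<close> and \<open>1 - Re Z\<close> the cosine and sine legs of a right triangle with
  hypotenuse \<open>\<rho>\<close>, so their quotient is the cotangent of the angle.\<close>

lemma psiX_eq:
  assumes "cmod X < 1"
  shows "psiX X \<phi> = pi / 2 - arctan (ncoord X \<phi>)"
proof -
  let ?c = "ncoord X \<phi>"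
  \<comment> \<open>This is the inverse cotangent with range strictly between 0 and
    \<open>pi\<close>.\<close>
  define \<psi>0 where "\<psi>0 = pi / 2 - arctan ?c"
  define Z where "Z = X * cis (- \<phi>)"
  define \<rho> where "\<rho> = cmod (X - Rpt \<phi>)"
  have n: "chord_num X \<phi> = Im Z" "chord_den X \<phi> = 1 - Re Z"
    unfolding Z_def by (rule chord_num_eq_Im, rule chord_den_eq_Re)
  have dp: "1 - Re Z > 0"
    using chord_den_pos[OF assms, of \<phi>] n by simp
  have R: "Rpt \<phi> = cis \<phi>" "evec \<phi> = \<i> * cis \<phi>"
    by (auto simp: Rpt_def evec_def complex_eq_iff)
  have X: "X = Z * cis \<phi>"
    by (simp add: Z_def cis_mult mult.assoc)
  have XR: "X - Rpt \<phi> = (Z - 1) * cis \<phi>"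
    unfolding R by (subst X) (simp add: algebra_simps)
  have rho: "\<rho> = cmod (Z - 1)"
    unfolding \<rho>_def XR by (simp add: norm_mult)
  have rho_pos: "\<rho> > 0"
    unfolding rho using dp by auto
  have iff: "X - Rpt \<phi> = of_real \<rho> * (cis \<psi> * evec \<phi>) \<longleftrightarrow> Im Z = \<rho> * cos \<psi> \<and> 1 - Re Z = \<rho> * sin \<psi>" for \<psi>
  proof -
    have "of_real \<rho> * (cis \<psi> * evec \<phi>) = (of_real \<rho> * (cis \<psi> * \<i>)) * cis \<phi>"
      by (simp only: R mult_ac)
    then have "X - Rpt \<phi> = of_real \<rho> * (cis \<psi> * evec \<phi>) \<longleftrightarrow> (Z - 1) * cis \<phi> = (of_real \<rho> * (cis \<psi> * \<i>)) * cis \<phi>"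
      by (simp only: XR)
    also have "\<dots> \<longleftrightarrow> Z - 1 = of_real \<rho> * (cis \<psi> * \<i>)"
      using cis_neq_zero[of \<phi>] by (simp only: mult_cancel_right) simp
    also have "\<dots> \<longleftrightarrow> Im Z = \<rho> * cos \<psi> \<and> 1 - Re Z = \<rho> * sin \<psi>"
      by (auto simp: complex_eq_iff)
    finally show ?thesis .
  qed
  have rng: "0 < \<psi>0" "\<psi>0 < pi"
    unfolding \<psi>0_def using arctan_lbound[of ?c] arctan_ubound[of ?c] by linarith+
  have sc: "sin \<psi>0 = 1 / sqrt (1 + ?c\<^sup>2)" "cos \<psi>0 = ?c / sqrt (1 + ?c\<^sup>2)"
    by (auto simp: \<psi>0_def sin_diff cos_diff cos_arctan sin_arctan)
  have "\<rho> = (1 - Re Z) * sqrt (1 + ?c\<^sup>2)"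
  proof (rule power2_eq_imp_eq)
    have "?c = Im Z / (1 - Re Z)" by (simp add: ncoord_def n)
    then have "(1 - Re Z) * ?c = Im Z" using dp by simp
    then have "(1 - Re Z)\<^sup>2 * ?c\<^sup>2 = (Im Z)\<^sup>2" by (metis power_mult_distrib)
    moreover have "\<rho>\<^sup>2 = (Re Z - 1)\<^sup>2 + (Im Z)\<^sup>2" by (simp add: rho cmod_power2)
    moreover have "(sqrt (1 + ?c\<^sup>2))\<^sup>2 = 1 + ?c\<^sup>2" by simp
    ultimately show "\<rho>\<^sup>2 = ((1 - Re Z) * sqrt (1 + ?c\<^sup>2))\<^sup>2" by algebra
  qed (use dp rho_pos in auto)
  moreover have "sqrt (1 + ?c\<^sup>2) > 0" by (simp add: add_pos_nonneg)
  ultimately have Z: "Im Z = \<rho> * cos \<psi>0 \<and> 1 - Re Z = \<rho> * sin \<psi>0"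
    using dp by (simp add: sc) (simp add: ncoord_def n)
  note sol = conjI[OF rng(1) conjI[OF rng(2) iff[THEN iffD2, OF Z]]]
  have "psiX X \<phi> = \<psi>0"
    unfolding psiX_def \<rho>_def[symmetric]
  proof (rule the_equality, rule sol)
    fix \<psi> assume *: "0 < \<psi> \<and> \<psi> < pi \<and> X - Rpt \<phi> = of_real \<rho> * (cis \<psi> * evec \<phi>)"
    from iff[THEN iffD1, OF conjunct2[OF conjunct2[OF *]]] have "Im Z = \<rho> * cos \<psi>"
      by (rule conjunct1)
    from trans[OF sym[OF this] conjunct1[OF Z]] have "cos \<psi> = cos \<psi>0" using rho_pos by simp
    then show "\<psi> = \<psi>0"
      by (rule cos_inj_pi[rotated 4]) (use conjunct1[OF *] conjunct1[OF conjunct2[OF *]] rng in simp_all)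
  qed
  then show ?thesis by (simp only: \<psi>0_def)
qed

section \<open>Extreme coordinates over a compact set\<close>

definition ncoord_max :: "complex set \<Rightarrow> real \<Rightarrow> real" where
  "ncoord_max K \<phi> = (SUP X\<in>K. ncoord X \<phi>)"

definition ncoord_min :: "complex set \<Rightarrow> real \<Rightarrow> real" where
  "ncoord_min K \<phi> = (INF X\<in>K. ncoord X \<phi>)"

text \<open>The modulus attains its maximum on \<open>K\<close>. A radius common to all points keeps
  every denominator away from 0 uniformly.\<close>

lemma compact_in_disc_radius:
  assumes "compact K" "K \<subseteq> kleinD"
  obtains r where "r < 1" "\<And>X. X \<in> K \<Longrightarrow> cmod X \<le> r"
proof (cases "K = {}")
  case True
  then show ?thesis using that[of 0] by auto
next
  case False
  have "continuous_on K cmod" by (intro continuous_intros)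
  then obtain X where "X \<in> K" "\<And>Y. Y \<in> K \<Longrightarrow> cmod Y \<le> cmod X"
    using continuous_attains_sup[OF assms(1) False] by metis
  then show ?thesis using that[of "cmod X"] assms(2) by (auto simp: kleinD_def)
qed

locale klein_compact =
  fixes K :: "complex set"
  assumes K_disc: "K \<subseteq> kleinD" and K_compact: "compact K" and K_nonempty: "K \<noteq> {}"
begin

lemma cmod_less_1: "X \<in> K \<Longrightarrow> cmod X < 1"
  using K_disc by (auto simp: kleinD_def)

lemma ncoord_lipschitz:
  obtains L where "L > 0"
    "\<And>X Y \<phi>. X \<in> K \<Longrightarrow> Y \<in> K \<Longrightarrow> \<bar>ncoord X \<phi> - ncoord Y \<phi>\<bar> \<le> L * cmod (X - Y)"
    "\<And>X a b. X \<in> K \<Longrightarrow> \<bar>ncoord X a - ncoord X b\<bar> \<le> L * \<bar>a - b\<bar>"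
proof -
  obtain r where "r < 1" "\<And>X. X \<in> K \<Longrightarrow> cmod X \<le> r"
    using compact_in_disc_radius[OF K_compact K_disc] by blast
  then show ?thesis
    using that[of "3 / (1 - r)\<^sup>2"] ncoord_lipschitz_point ncoord_lipschitz_angle by auto
qed

lemma ncoord_continuous_point: "continuous_on K (\<lambda>X. ncoord X \<phi>)"
proof -
  have "chord_den X \<phi> \<noteq> 0" if "X \<in> K" for X
    using chord_den_pos[OF cmod_less_1[OF that], of \<phi>] by simp
  then show ?thesis
    unfolding ncoord_def chord_num_def chord_den_def by (intro continuous_intros) auto
qed

lemma ncoord_max_attained: "\<exists>X\<in>K. ncoord X \<phi> = ncoord_max K \<phi> \<and> (\<forall>Y\<in>K. ncoord Y \<phi> \<le> ncoord_max K \<phi>)"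
proof -
  obtain X where X: "X \<in> K" "\<forall>Y\<in>K. ncoord Y \<phi> \<le> ncoord X \<phi>"
    using continuous_attains_sup[OF K_compact K_nonempty ncoord_continuous_point] by blast
  then have "ncoord_max K \<phi> = ncoord X \<phi>"
    unfolding ncoord_max_def by (intro cSup_eq_maximum) auto
  with X show ?thesis by auto
qed

lemma ncoord_min_attained: "\<exists>X\<in>K. ncoord X \<phi> = ncoord_min K \<phi> \<and> (\<forall>Y\<in>K. ncoord_min K \<phi> \<le> ncoord Y \<phi>)"
proof -
  obtain X where X: "X \<in> K" "\<forall>Y\<in>K. ncoord X \<phi> \<le> ncoord Y \<phi>"
    using continuous_attains_inf[OF K_compact K_nonempty ncoord_continuous_point] by blast
  then have "ncoord_min K \<phi> = ncoord X \<phi>"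
    unfolding ncoord_min_def by (intro cInf_eq_minimum) auto
  with X show ?thesis by auto
qed

lemma ncoord_le_max: "X \<in> K \<Longrightarrow> ncoord X \<phi> \<le> ncoord_max K \<phi>"
  and min_le_ncoord: "X \<in> K \<Longrightarrow> ncoord_min K \<phi> \<le> ncoord X \<phi>"
  using ncoord_max_attained ncoord_min_attained by blast+

text \<open>An extremal point at one angle competes at the other, so the extrema inherit the
  Lipschitz constant shared by all coordinates. Besides continuity, the bound later stands in for
  differentiability of the maximum.\<close>

lemma ncoord_extrema_lipschitz:
  obtains L where "L > 0"
    "\<And>a b. \<bar>ncoord_max K a - ncoord_max K b\<bar> \<le> L * \<bar>a - b\<bar>"
    "\<And>a b. \<bar>ncoord_min K a - ncoord_min K b\<bar> \<le> L * \<bar>a - b\<bar>"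
proof -
  obtain L where L: "L > 0" "\<And>X a b. X \<in> K \<Longrightarrow> \<bar>ncoord X a - ncoord X b\<bar> \<le> L * \<bar>a - b\<bar>"
    using ncoord_lipschitz by metis
  have 1: "ncoord_max K a \<le> ncoord_max K b + L * \<bar>a - b\<bar>" for a b
  proof -
    obtain X where "X \<in> K" "ncoord X a = ncoord_max K a" using ncoord_max_attained by blast
    then show ?thesis using L(2)[of X a b] ncoord_le_max[of X b] by linarith
  qed
  have 2: "ncoord_min K b \<le> ncoord_min K a + L * \<bar>a - b\<bar>" for a b
  proof -
    obtain X where "X \<in> K" "ncoord X a = ncoord_min K a" using ncoord_min_attained by blast
    then show ?thesis using L(2)[of X a b] min_le_ncoord[of X b] by linarith
  qed
  show ?thesis
  proof (rule that[OF L(1)])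
    fix a b
    show "\<bar>ncoord_max K a - ncoord_max K b\<bar> \<le> L * \<bar>a - b\<bar>"
      using 1[of a b] 1[of b a] by (simp add: abs_minus_commute)
    show "\<bar>ncoord_min K a - ncoord_min K b\<bar> \<le> L * \<bar>a - b\<bar>"
      using 2[of a b] 2[of b a] by (simp add: abs_minus_commute)
  qed
qed

lemma ncoord_max_continuous: "continuous_on S (ncoord_max K)"
  and ncoord_min_continuous: "continuous_on S (ncoord_min K)"
proof -
  obtain L where L: "L > 0"
    "\<And>a b. \<bar>ncoord_max K a - ncoord_max K b\<bar> \<le> L * \<bar>a - b\<bar>"
    "\<And>a b. \<bar>ncoord_min K a - ncoord_min K b\<bar> \<le> L * \<bar>a - b\<bar>"
    using ncoord_extrema_lipschitz by metis
  show "continuous_on S (ncoord_max K)" "continuous_on S (ncoord_min K)"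
    by (rule lipschitz_on_continuous_on[of L], rule lipschitz_onI, use L in \<open>auto simp: dist_real_def\<close>)+
qed

text \<open>The angle decreases as the coordinate grows, so the least angle occurs at the greatest
  coordinate, and the cotangent undoes \<open>pi / 2 - arctan\<close>.\<close>

lemma supp_h_eq_ncoord_max: "supp_h K = ncoord_max K"
proof
  fix \<phi>
  obtain X where X: "X \<in> K" "ncoord X \<phi> = ncoord_max K \<phi>" using ncoord_max_attained by blast
  have "psi1 K \<phi> = pi / 2 - arctan (ncoord_max K \<phi>)"
    unfolding psi1_def
  proof (rule cInf_eq_minimum)
    show "pi / 2 - arctan (ncoord_max K \<phi>) \<in> (\<lambda>X. psiX X \<phi>) ` K"
      using X by (intro image_eqI[of _ _ X]) (simp_all add: psiX_eq cmod_less_1)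
    show "pi / 2 - arctan (ncoord_max K \<phi>) \<le> y" if "y \<in> (\<lambda>X. psiX X \<phi>) ` K" for y
      using that ncoord_le_max by (auto simp: psiX_eq cmod_less_1 arctan_le_iff)
  qed
  moreover have "1 + (ncoord_max K \<phi>)\<^sup>2 \<noteq> 0"
    using zero_le_power2[of "ncoord_max K \<phi>"] by linarith
  ultimately show "supp_h K \<phi> = ncoord_max K \<phi>"
    by (simp add: supp_h_def cot_def cos_diff sin_diff sin_arctan cos_arctan)
qed

end

subsection \<open>Crofton's formula for the Hilbert metric\<close>

text \<open>One primitive on the whole line with two-sided derivatives, so that it can be shifted
  and composed freely.\<close>

lemma continuous_antiderivative:
  fixes f :: "real \<Rightarrow> real"
  assumes "continuous_on UNIV f"
  shows "\<exists>F. \<forall>x. (F has_real_derivative f x) (at x)"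
proof -
  have "\<exists>F. \<forall>x. -\<infinity> < ereal x \<longrightarrow> ereal x < \<infinity> \<longrightarrow> (F has_vector_derivative f x) (at x)"
    using assms by (intro einterval_antiderivative) (auto simp: continuous_on_eq_continuous_at)
  then obtain F where "\<forall>x. (F has_vector_derivative f x) (at x)" by auto
  then show ?thesis
    by (intro exI[of _ F]) (simp add: has_real_derivative_iff_has_vector_derivative)
qed

text \<open>For a primitive \<open>F\<close>, the difference \<open>F (x + p) - F x\<close> has
  derivative \<open>f (x + p) - f x = 0\<close>, so it does not depend on the starting
  point.\<close>

lemma integral_periodic:
  fixes f :: "real \<Rightarrow> real"
  assumes "continuous_on UNIV f" "\<And>x. f (x + p) = f x" "0 \<le> p"
  shows "integral {a..a + p} f = integral {b..b + p} f"
proof -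
  obtain F where F: "\<And>x. (F has_real_derivative f x) (at x)"
    using continuous_antiderivative[OF assms(1)] by blast
  have int: "integral {c..c + p} f = F (c + p) - F c" for c
    using assms(3) F by (intro integral_unique fundamental_theorem_of_calculus)
      (auto simp: has_real_derivative_iff_has_vector_derivative[symmetric] intro: has_field_derivative_at_within)
  define D where "D x = F (x + p) - F x" for x
  have "(D has_real_derivative 0) (at x)" for x
    using DERIV_diff[OF F[of "x + p", unfolded DERIV_shift] F[of x]] assms(2)
    unfolding D_def[abs_def] by simp
  then have "D a = D b"
    using DERIV_isconst_all by blast
  then have "F (a + p) - F a = F (b + p) - F b"
    by (simp add: D_def)
  then show ?thesis by (simp add: int)
qed

text \<open>Existence is the intermediate value theorem. For uniqueness,
  \<open>(cmod (P + of_real s * V))\<^sup>2 - 1\<close> is a quadratic in \<open>s\<close> that is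
  negative at 0, so its two roots cannot both be negative.\<close>

lemma ex1_circle_backward:
  fixes P V :: complex
  assumes "cmod P < 1" "V \<noteq> 0"
  shows "\<exists>!s. s < 0 \<and> cmod (P + of_real s * V) = 1"
proof (rule ex_ex1I)
  \<comment> \<open>This parameter displaces \<open>P\<close> by exactly 2, hence out of the
    disc.\<close>
  have "1 \<le> cmod (P + of_real (- 2 / cmod V) * V)"
  proof -
    have "cmod (of_real (- 2 / cmod V) * V) = 2"
      using assms by (simp add: norm_mult norm_divide)
    then show ?thesis
      using norm_diff_ineq[of "of_real (- 2 / cmod V) * V" P] assms(1) by (simp add: add.commute)
  qed
  then have "\<exists>s. - 2 / cmod V \<le> s \<and> s \<le> 0 \<and> cmod (P + of_real s * V) = 1"
    using assms by (intro IVT2') (auto intro!: continuous_intros)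
  then obtain s where s: "s \<le> 0" "cmod (P + of_real s * V) = 1" by blast
  then have "s \<noteq> 0" using assms by auto
  with s show "\<exists>s. s < 0 \<and> cmod (P + of_real s * V) = 1"
    by (intro exI[of _ s]) auto
next
  fix s t assume st: "s < 0 \<and> cmod (P + of_real s * V) = 1" "t < 0 \<and> cmod (P + of_real t * V) = 1"
  define b where "b = Re P * Re V + Im P * Im V"
  have sq: "(cmod P)\<^sup>2 + 2 * x * b + x\<^sup>2 * (cmod V)\<^sup>2 = 1" if "cmod (P + of_real x * V) = 1" for x
  proof -
    have "(cmod P)\<^sup>2 + 2 * x * b + x\<^sup>2 * (cmod V)\<^sup>2 = (cmod (P + of_real x * V))\<^sup>2"
      unfolding cmod_power2 b_def by (simp add: power2_eq_square algebra_simps)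
    then show ?thesis using that by simp
  qed
  show "s = t"
  proof (rule ccontr)
    assume "s \<noteq> t"
    \<comment> \<open>Subtracting the two circle equations and cancelling \<open>s - t\<close> gives
      the sum of the roots; eliminating \<open>b\<close> then gives their product.\<close>
    have "(s - t) * (2 * b + (s + t) * (cmod V)\<^sup>2) = 0"
      using sq[of s] sq[of t] st by (simp add: algebra_simps power2_eq_square)
    then have "2 * b + (s + t) * (cmod V)\<^sup>2 = 0"
      using \<open>s \<noteq> t\<close> by (simp only: mult_eq_0_iff right_minus_eq simp_thms)
    moreover have "(cmod P)\<^sup>2 + 2 * s * b + s\<^sup>2 * (cmod V)\<^sup>2 = 1"
      using sq[of s] st by simp
    ultimately have "(cmod P)\<^sup>2 = 1 + s * t * (cmod V)\<^sup>2"
      by algebra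
    moreover have "s * t * (cmod V)\<^sup>2 > 0"
      using st assms by (simp add: mult_neg_neg)
    moreover have "(cmod P)\<^sup>2 < 1"
      using assms by (simp add: abs_square_less_1)
    ultimately show False by linarith
  qed
qed

lemma chordA_param:
  assumes "cmod P < 1" "P \<noteq> Q"
  obtains a where "a < 0" "chordA P Q = P + of_real a * (Q - P)" "cmod (chordA P Q) = 1"
  using theI'[OF ex1_circle_backward[of P "Q - P"]] assms that unfolding chordA_def by auto

text \<open>Replacing \<open>s\<close> by \<open>1 - s\<close> exchanges \<open>P\<close> and
  \<open>Q\<close> and turns the forward end into a backward one.\<close>

lemma chordB_param:
  assumes "cmod Q < 1" "P \<noteq> Q"
  obtains b where "1 < b" "chordB P Q = P + of_real b * (Q - P)" "cmod (chordB P Q) = 1"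
proof -
  have eq: "Q + of_real (1 - s) * (P - Q) = P + of_real s * (Q - P)" for s
    by (simp add: algebra_simps)
  have "\<exists>!s. s < 0 \<and> cmod (Q + of_real s * (P - Q)) = 1"
    using assms by (intro ex1_circle_backward) auto
  then obtain s where s: "s < 0" "cmod (Q + of_real s * (P - Q)) = 1"
    and uniq: "\<And>t. t < 0 \<Longrightarrow> cmod (Q + of_real t * (P - Q)) = 1 \<Longrightarrow> t = s" by blast
  have "\<exists>!s. 1 < s \<and> cmod (P + of_real s * (Q - P)) = 1"
  proof (rule ex1I[of _ "1 - s"])
    show "1 < 1 - s \<and> cmod (P + of_real (1 - s) * (Q - P)) = 1"
      using s eq[of "1 - s"] by simp
    show "t = 1 - s" if "1 < t \<and> cmod (P + of_real t * (Q - P)) = 1" for t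
      using uniq[of "1 - t"] that eq[of t] by simp
  qed
  from theI'[OF this] show ?thesis
    using that unfolding chordB_def by auto
qed

text \<open>A full turn is added to the second principal argument when it is the smaller, so the
  circle splits into the arcs from \<alpha> to \<beta> and from \<beta> to
  \<open>\<alpha> + 2 * pi\<close>.\<close>

lemma unit_circle_angles:
  assumes "cmod A = 1" "cmod B = 1" "A \<noteq> B"
  obtains \<alpha> \<beta> where "A = cis \<alpha>" "B = cis \<beta>" "\<alpha> < \<beta>" "\<beta> < \<alpha> + 2 * pi"
proof -
  have AB: "A = cis (Arg A)" "B = cis (Arg B)"
    using assms by (metis rcis_cmod_Arg rcis_def mult_1 of_real_1)+
  have neq: "Arg A \<noteq> Arg B" using AB assms(3) by metis
  have bd: "- pi < Arg A" "Arg A \<le> pi" "- pi < Arg B" "Arg B \<le> pi"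
    using Arg_bounded by auto
  show ?thesis
  proof (cases "Arg A < Arg B")
    case True
    then show ?thesis using bd by (intro that[OF AB]) simp_all
  next
    case False
    have "cis (Arg B + 2 * pi) = cis (Arg B)" by (simp add: complex_eq_iff)
    from that[OF AB(1) trans[OF AB(2) sym[OF this]]] show ?thesis
      using bd False neq by linarith
  qed
qed

text \<open>Up to sign this is twice the signed area of a triangle inscribed in the unit circle with
  arcs \<open>2 * x\<close> and \<open>2 * y\<close>; the product form exhibits its sign.\<close>

lemma sin_chord_identity:
  fixes x y :: real
  shows "sin (2 * x + 2 * y) - sin (2 * y) - sin (2 * x) = - 4 * sin (x + y) * sin x * sin y"
proof -
  have "sin (2 * x + 2 * y) - sin (2 * y) - sin (2 * x)
      = 2 * sin x * cos x * (cos (2 * y) - 1) + 2 * sin y * cos y * (cos (2 * x) - 1)"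
    unfolding sin_add sin_double by (simp add: algebra_simps)
  also have "\<dots> = - 4 * sin (x + y) * sin x * sin y"
    unfolding sin_add cos_double_sin by (simp add: algebra_simps power2_eq_square)
  finally show ?thesis .
qed

text \<open>The numerator is the determinant of \<open>P - Rpt \<phi>\<close> and
  \<open>Q - Rpt \<phi>\<close>, twice the signed area of the triangle that \<open>P\<close> and
  \<open>Q\<close> form with \<open>Rpt \<phi>\<close>.\<close>

lemma ncoord_diff_eq:
  assumes "cmod P < 1" "cmod Q < 1"
  shows "ncoord P \<phi> - ncoord Q \<phi> =
    (Re P * Im Q - Im P * Re Q - chord_num (Q - P) \<phi>) / (chord_den P \<phi> * chord_den Q \<phi>)"
proof -
  have "chord_num P \<phi> * chord_den Q \<phi> - chord_num Q \<phi> * chord_den P \<phi>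
      = Re P * Im Q - Im P * Re Q - chord_num (Q - P) \<phi>"
    unfolding chord_num_def chord_den_def minus_complex.simps using sin_cos_squared_add[of \<phi>] by algebra
  then show ?thesis
    using chord_den_pos[OF assms(1), of \<phi>] chord_den_pos[OF assms(2), of \<phi>]
    by (simp add: ncoord_def diff_frac_eq mult.commute)
qed

text \<open>The sign of \<open>ncoord P - ncoord Q\<close> changes exactly
  at the two ends of the chord through \<open>P\<close> and \<open>Q\<close>, and each of the two arcs contributes
  \<open>2 * hdist P Q\<close>.\<close>

lemma hdist_crofton:
  assumes "cmod P < 1" "cmod Q < 1"
  shows "((\<lambda>\<phi>. \<bar>ncoord P \<phi> - ncoord Q \<phi>\<bar>) has_integral 4 * hdist P Q) {0..2 * pi}"
proof (cases "P = Q")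
  case True
  then show ?thesis by (simp add: hdist_def)
next
  case False
  define V where "V = Q - P"
  obtain a where a: "a < 0" "chordA P Q = P + of_real a * V" "cmod (chordA P Q) = 1"
    using chordA_param[OF assms(1) False] unfolding V_def .
  obtain b where b: "1 < b" "chordB P Q = P + of_real b * V" "cmod (chordB P Q) = 1"
    using chordB_param[OF assms(2) False] unfolding V_def .
  have V: "V \<noteq> 0" using False by (simp add: V_def)
  have "chordA P Q \<noteq> chordB P Q" using a b V by auto
  then obtain \<alpha> \<beta> where A: "chordA P Q = cis \<alpha>" and B: "chordB P Q = cis \<beta>"
    and \<alpha>\<beta>: "\<alpha> < \<beta>" "\<beta> < \<alpha> + 2 * pi"
    using unit_circle_angles[OF a(3) b(3)] by metis
  have PA: "P = cis \<alpha> - of_real a * V" "Q = cis \<alpha> - of_real (a - 1) * V"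
    using a(2) A by (simp_all add: V_def algebra_simps)
  have PB: "P = cis \<beta> - of_real b * V" "Q = cis \<beta> - of_real (b - 1) * V"
    using b(2) B by (simp_all add: V_def algebra_simps)
  \<comment> \<open>Here \<open>1 - chord_den V \<theta>\<close> is the inner product of
    \<open>V\<close> and \<open>Rpt \<theta>\<close>. At a chord end the denominators of
    \<open>P\<close> and \<open>Q\<close> are thus proportional to their parameter offsets from that
    end.\<close>
  have den: "chord_den (cis \<theta> - of_real s * V) \<theta> = s * (1 - chord_den V \<theta>)" for s \<theta>
  proof -
    have "Re (cis \<theta> - of_real s * V) = cos \<theta> - s * Re V" "Im (cis \<theta> - of_real s * V) = sin \<theta> - s * Im V"
      by simp_all
    then show ?thesis
      unfolding chord_den_def using sin_cos_squared_add[of \<theta>] by algebra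
  qed
  define k where "k = 1 - chord_den V \<alpha>"
  define l where "l = 1 - chord_den V \<beta>"
  have dA: "chord_den P \<alpha> = a * k" "chord_den Q \<alpha> = (a - 1) * k"
    unfolding k_def by (subst PA(1), rule den, subst PA(2), rule den)
  have dB: "chord_den P \<beta> = b * l" "chord_den Q \<beta> = (b - 1) * l"
    unfolding l_def by (subst PB(1), rule den, subst PB(2), rule den)
  have "a * k > 0" "b * l > 0"
    using chord_den_pos[OF assms(1)] dA dB by metis+
  then have kl: "k < 0" "l > 0"
    using a b by (auto simp: zero_less_mult_iff)
  \<comment> \<open>A primitive of \<open>ncoord Q - ncoord P\<close>; at the chord ends the common
    factors \<open>k\<close> and \<open>l\<close> cancel.\<close>
  define h where "h \<phi> = ln (chord_den P \<phi>) - ln (chord_den Q \<phi>)" for \<phi>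
  have hA: "h \<alpha> = ln (- a) - ln (1 - a)"
    using a kl ln_mult[of "- a" "- k"] ln_mult[of "1 - a" "- k"] unfolding h_def dA
    by (simp add: algebra_simps)
  have hB: "h \<beta> = ln b - ln (b - 1)"
    using b kl unfolding h_def dB by (simp add: ln_mult)
  have hdist: "2 * hdist P Q = h \<beta> - h \<alpha>"
  proof -
    have "dist (chordA P Q) P = (- a) * cmod V"
      using a by (simp add: dist_norm norm_mult)
    moreover have "chordA P Q - Q = of_real (a - 1) * V"
      unfolding a(2) by (simp add: V_def algebra_simps)
    then have "dist (chordA P Q) Q = (1 - a) * cmod V"
      by (simp only: dist_norm norm_mult norm_of_real) (use a in \<open>simp add: abs_if\<close>)
    moreover have "dist (chordB P Q) P = b * cmod V"
      using b by (simp add: dist_norm norm_mult)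
    moreover have "chordB P Q - Q = of_real (b - 1) * V"
      unfolding b(2) by (simp add: V_def algebra_simps)
    then have "dist (chordB P Q) Q = (b - 1) * cmod V"
      by (simp only: dist_norm norm_mult norm_of_real) (use b in \<open>simp add: abs_if\<close>)
    ultimately have "2 * hdist P Q = ln ((1 - a) / (- a) * (b / (b - 1)))"
      using False V unfolding hdist_def by simp
    also have "\<dots> = ln ((1 - a) / (- a)) + ln (b / (b - 1))"
      using a b by (intro ln_mult_pos divide_pos_pos) auto
    also have "\<dots> = h \<beta> - h \<alpha>"
      using a b unfolding hA hB by (subst (1 2) ln_div) auto
    finally show ?thesis .
  qed
  have deriv: "(h has_real_derivative (ncoord Q \<phi> - ncoord P \<phi>)) (at \<phi> within S)" for \<phi> S
    using DERIV_diff[OF ncoord_eq_log_derivative[OF assms(2)] ncoord_eq_log_derivative[OF assms(1)], of \<phi> S]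
    unfolding h_def[abs_def] by (simp add: algebra_simps)
  \<comment> \<open>Scaling by \<open>b - a\<close> replaces \<open>V\<close> by the full chord
    \<open>cis \<beta> - cis \<alpha>\<close>, so the determinant becomes that of the triangle
    inscribed at the angles \<alpha>, \<phi> and \<beta>.\<close>
  have sign: "(b - a) * (Re P * Im Q - Im P * Re Q - chord_num (Q - P) \<phi>)
      = - 4 * sin ((\<beta> - \<alpha>) / 2) * sin ((\<phi> - \<alpha>) / 2) * sin ((\<beta> - \<phi>) / 2)" for \<phi>
  proof -
    have W: "of_real (b - a) * V = cis \<beta> - cis \<alpha>"
      using PA(1) PB(1) by (simp add: algebra_simps)
    then have W': "(b - a) * Re V = cos \<beta> - cos \<alpha>" "(b - a) * Im V = sin \<beta> - sin \<alpha>"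
      by (simp_all add: complex_eq_iff)
    have "(b - a) * (Re P * Im Q - Im P * Re Q - chord_num (Q - P) \<phi>)
        = cos \<alpha> * ((b - a) * Im V) - sin \<alpha> * ((b - a) * Re V)
          - ((b - a) * Im V * cos \<phi> - (b - a) * Re V * sin \<phi>)"
      unfolding chord_num_def V_def[symmetric] 
      by (simp add: PA algebra_simps)
    also have "\<dots> = sin (\<beta> - \<alpha>) - sin (\<beta> - \<phi>) - sin (\<phi> - \<alpha>)"
      unfolding W' sin_diff by (simp add: algebra_simps)
    also have "\<dots> = - 4 * sin ((\<beta> - \<alpha>) / 2) * sin ((\<phi> - \<alpha>) / 2) * sin ((\<beta> - \<phi>) / 2)"
    proof -
      have "2 * ((\<phi> - \<alpha>) / 2) + 2 * ((\<beta> - \<phi>) / 2) = \<beta> - \<alpha>" "2 * ((\<beta> - \<phi>) / 2) = \<beta> - \<phi>"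
        "2 * ((\<phi> - \<alpha>) / 2) = \<phi> - \<alpha>" "(\<phi> - \<alpha>) / 2 + (\<beta> - \<phi>) / 2 = (\<beta> - \<alpha>) / 2"
        by (simp_all add: field_simps)
      then show ?thesis
        using sin_chord_identity[of "(\<phi> - \<alpha>) / 2" "(\<beta> - \<phi>) / 2"] by (simp only:)
    qed
    finally show ?thesis .
  qed
  have ncoord_sign: "ncoord P \<phi> - ncoord Q \<phi> =
      - 4 * sin ((\<beta> - \<alpha>) / 2) * sin ((\<phi> - \<alpha>) / 2) * sin ((\<beta> - \<phi>) / 2) / ((b - a) * (chord_den P \<phi> * chord_den Q \<phi>))" for \<phi>
    unfolding ncoord_diff_eq[OF assms] sign[symmetric] using a b by simp
  have pos: "0 < (b - a) * (chord_den P \<phi> * chord_den Q \<phi>)" for \<phi>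
    using chord_den_pos[OF assms(1), of \<phi>] chord_den_pos[OF assms(2), of \<phi>] a b by simp
  have s0: "0 < sin ((\<beta> - \<alpha>) / 2)" using \<alpha>\<beta> by (intro sin_gt_zero) auto
  have "((\<lambda>\<phi>. \<bar>ncoord P \<phi> - ncoord Q \<phi>\<bar>) has_integral (h \<beta> - h \<alpha>)) {\<alpha>..\<beta>}"
  proof (rule has_integral_eq)
    show "((\<lambda>\<phi>. ncoord Q \<phi> - ncoord P \<phi>) has_integral (h \<beta> - h \<alpha>)) {\<alpha>..\<beta>}"
      using \<alpha>\<beta> deriv by (intro fundamental_theorem_of_calculus)
        (auto simp: has_real_derivative_iff_has_vector_derivative[symmetric])
    fix \<phi> assume "\<phi> \<in> {\<alpha>..\<beta>}"
    then have "0 \<le> sin ((\<phi> - \<alpha>) / 2)" "0 \<le> sin ((\<beta> - \<phi>) / 2)"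
      using \<alpha>\<beta> by (auto intro!: sin_ge_zero)
    then have "ncoord P \<phi> - ncoord Q \<phi> \<le> 0"
      unfolding ncoord_sign using pos[of \<phi>] s0 by (intro divide_nonpos_pos) auto
    then show "ncoord Q \<phi> - ncoord P \<phi> = \<bar>ncoord P \<phi> - ncoord Q \<phi>\<bar>" by simp
  qed
  \<comment> \<open>On the complementary arc one sine factor changes sign, so \<open>- h\<close> is
    the primitive of the absolute value.\<close>
  moreover have "((\<lambda>\<phi>. \<bar>ncoord P \<phi> - ncoord Q \<phi>\<bar>) has_integral (- h (\<alpha> + 2 * pi) - - h \<beta>)) {\<beta>..\<alpha> + 2 * pi}"
  proof (rule has_integral_eq)
    show "((\<lambda>\<phi>. ncoord P \<phi> - ncoord Q \<phi>) has_integral (- h (\<alpha> + 2 * pi) - - h \<beta>)) {\<beta>..\<alpha> + 2 * pi}"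
      using \<alpha>\<beta> DERIV_minus[OF deriv] by (intro fundamental_theorem_of_calculus)
        (auto simp: has_real_derivative_iff_has_vector_derivative[symmetric])
    fix \<phi> assume "\<phi> \<in> {\<beta>..\<alpha> + 2 * pi}"
    then have "0 \<le> sin ((\<phi> - \<alpha>) / 2)" "0 \<le> sin ((\<phi> - \<beta>) / 2)"
      using \<alpha>\<beta> by (auto intro!: sin_ge_zero)
    moreover have "sin ((\<beta> - \<phi>) / 2) = - sin ((\<phi> - \<beta>) / 2)"
      using sin_minus[of "(\<phi> - \<beta>) / 2"] by (simp only: minus_divide_left minus_diff_eq)
    ultimately have "0 \<le> ncoord P \<phi> - ncoord Q \<phi>"
      unfolding ncoord_sign using pos[of \<phi>] s0 by (intro divide_nonneg_pos) auto
    then show "ncoord P \<phi> - ncoord Q \<phi> = \<bar>ncoord P \<phi> - ncoord Q \<phi>\<bar>" by simp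
  qed
  \<comment> \<open>By periodicity of \<open>h\<close> both arcs contribute the same amount.\<close>
  moreover have "h (\<alpha> + 2 * pi) = h \<alpha>"
    by (simp add: h_def chord_den_def)
  moreover have "4 * hdist P Q = 2 * h \<beta> - 2 * h \<alpha>" using hdist by simp
  ultimately have "((\<lambda>\<phi>. \<bar>ncoord P \<phi> - ncoord Q \<phi>\<bar>) has_integral 4 * hdist P Q) {\<alpha>..\<alpha> + 2 * pi}"
    using has_integral_combine[of \<alpha> \<beta> "\<alpha> + 2 * pi" "\<lambda>\<phi>. \<bar>ncoord P \<phi> - ncoord Q \<phi>\<bar>" "h \<beta> - h \<alpha>" "h \<beta> - h \<alpha>"]
      \<alpha>\<beta> by simp
  then have "integral {\<alpha>..\<alpha> + 2 * pi} (\<lambda>\<phi>. \<bar>ncoord P \<phi> - ncoord Q \<phi>\<bar>) = 4 * hdist P Q"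
    by (rule integral_unique)
  moreover have cont: "continuous_on S (\<lambda>\<phi>. \<bar>ncoord P \<phi> - ncoord Q \<phi>\<bar>)" for S
    by (intro continuous_intros ncoord_continuous assms)
  ultimately have "integral {0..2 * pi} (\<lambda>\<phi>. \<bar>ncoord P \<phi> - ncoord Q \<phi>\<bar>) = 4 * hdist P Q"
    using integral_periodic[OF cont, of "2 * pi" \<alpha> 0] by simp
  then show ?thesis
    using integrable_continuous_interval[OF cont] by (simp add: has_integral_iff)
qed

subsection \<open>Right-hand and left-hand support lines\<close>

text \<open>A step of size \<open>norm (y - x)\<close> moves the point on the graph by at most
  \<open>1 + L\<close> times as much, so an error of smaller order in the plane stays of smaller
  order in \<open>y\<close>. \<open>M\<close> itself may have corners.\<close>

lemma has_derivative_zero_along_lipschitz_graph: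
  fixes H :: "real \<times> real \<Rightarrow> real" and M :: "real \<Rightarrow> real"
  assumes H: "(H has_derivative (\<lambda>_. 0)) (at (x, M x))"
    and lip: "\<And>a b. \<bar>M a - M b\<bar> \<le> L * \<bar>a - b\<bar>"
  shows "((\<lambda>y. H (y, M y)) has_derivative (\<lambda>_. 0)) (at x)"
  unfolding has_derivative_at_alt
proof (intro conjI allI impI)
  fix e :: real assume "e > 0"
  have "L \<ge> 0" using lip[of 0 1] by simp
  have dist: "norm ((y, M y) - (x, M x)) \<le> (1 + L) * norm (y - x)" for y
    using norm_Pair_le[of "y - x" "M y - M x"] lip[of y x] by (simp add: algebra_simps)
  \<comment> \<open>Dividing the tolerance by \<open>1 + L\<close> absorbs the stretching along the
    graph.\<close>
  have "e / (1 + L) > 0" using \<open>e > 0\<close> \<open>L \<ge> 0\<close> by simp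
  then obtain d where d: "d > 0"
    "\<And>z. norm (z - (x, M x)) < d \<Longrightarrow> norm (H z - H (x, M x)) \<le> e / (1 + L) * norm (z - (x, M x))"
    using H unfolding has_derivative_at_alt by (metis diff_zero)
  show "\<exists>d>0. \<forall>y. norm (y - x) < d \<longrightarrow> norm (H (y, M y) - H (x, M x) - 0) \<le> e * norm (y - x)"
  proof (intro exI[of _ "d / (1 + L)"] conjI allI impI)
    show "d / (1 + L) > 0" using d \<open>L \<ge> 0\<close> by simp
    fix y assume "norm (y - x) < d / (1 + L)"
    then have "(1 + L) * norm (y - x) < d"
      using \<open>L \<ge> 0\<close> by (simp add: field_simps)
    then have "norm (H (y, M y) - H (x, M x)) \<le> e / (1 + L) * norm ((y, M y) - (x, M x))"
      using dist[of y] by (intro d(2)) linarith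
    also have "\<dots> \<le> e / (1 + L) * ((1 + L) * norm (y - x))"
      using dist[of y] \<open>e / (1 + L) > 0\<close> by (intro mult_left_mono) auto
    also have "\<dots> = e * norm (y - x)" using \<open>L \<ge> 0\<close> by simp
    finally show "norm (H (y, M y) - H (x, M x) - 0) \<le> e * norm (y - x)" by simp
  qed
qed simp

text \<open>With \<open>v = cot \<psi>\<close> the angle \<open>\<phi> + pi - 2 * arctan v = \<phi> + 2 * \<psi>\<close> is the position of the other end
  of the chord leaving \<open>Rpt \<phi>\<close> at angle \<open>\<psi>\<close>.\<close>

lemma chord_other_end:
  "chord_num X (\<phi> + pi - 2 * arctan v) + v * chord_den X (\<phi> + pi - 2 * arctan v)
    = - (chord_num X \<phi> - v * chord_den X \<phi>)"
proof -
  \<comment> \<open>Multiplication by \<open>q\<close> clears the denominators in the double-angle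
    formulas for \<open>arctan v\<close>, leaving a polynomial identity.\<close>
  define q where "q = 1 + v\<^sup>2"
  define x where "x = Re X * cos \<phi> + Im X * sin \<phi>"
  define y where "y = Im X * cos \<phi> - Re X * sin \<phi>"
  have q: "q > 0" using zero_le_power2[of v] unfolding q_def by linarith
  have "q * (cos (arctan v))\<^sup>2 = 1" "sin (arctan v) = v * cos (arctan v)"
    using q by (simp_all add: cos_arctan sin_arctan power_divide q_def)
  then have cs: "q * cos (2 * arctan v) = 1 - v\<^sup>2" "q * sin (2 * arctan v) = 2 * v"
    unfolding cos_double sin_double by algebra+
  have c: "cos (\<phi> + pi - \<theta>) = - cos \<phi> * cos \<theta> - sin \<phi> * sin \<theta>"
    and s: "sin (\<phi> + pi - \<theta>) = - sin \<phi> * cos \<theta> + cos \<phi> * sin \<theta>" for \<theta>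
    by (simp_all add: cos_diff sin_diff)
  have num: "chord_num X (\<phi> + pi - \<theta>) = - y * cos \<theta> - x * sin \<theta>"
    and den: "chord_den X (\<phi> + pi - \<theta>) = 1 + x * cos \<theta> - y * sin \<theta>" for \<theta>
    unfolding chord_num_def chord_den_def c s x_def y_def by (simp_all add: algebra_simps)
  define s where "s = chord_num X (\<phi> + pi - 2 * arctan v) + v * chord_den X (\<phi> + pi - 2 * arctan v)"
  have "q * s
      = - y * (q * cos (2 * arctan v)) - x * (q * sin (2 * arctan v))
        + v * (q + x * (q * cos (2 * arctan v)) - y * (q * sin (2 * arctan v)))"
    unfolding s_def num den by (simp add: algebra_simps)
  also have "\<dots> = q * (v - y - v * x)"
    unfolding cs by (simp add: q_def algebra_simps power2_eq_square)
  finally have "s = v - y - v * x" using q by simp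
  also have "\<dots> = - (chord_num X \<phi> - v * chord_den X \<phi>)"
    unfolding chord_num_def chord_den_def x_def y_def by (simp add: algebra_simps)
  finally show ?thesis unfolding s_def .
qed

context klein_compact begin

text \<open>By \<open>chord_other_end\<close> the affine form of the support line changes sign
  between its two ends. The upper bound on \<open>K\<close> becomes a lower bound, with equality at
  the same touching point.\<close>

lemma ncoord_min_other_end:
  "ncoord_min K (\<phi> + pi - 2 * arctan (ncoord_max K \<phi>)) = - ncoord_max K \<phi>"
proof -
  let ?v = "ncoord_max K \<phi>"
  let ?T = "\<phi> + pi - 2 * arctan ?v"
  have ge: "- ?v \<le> ncoord X ?T" if "X \<in> K" for X
    using ncoord_le_max[OF that, of \<phi>] chord_other_end[of X \<phi> ?v]
    by (simp add: ncoord_le_iff cmod_less_1[OF that])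
  obtain X where X: "X \<in> K" "ncoord X \<phi> = ?v" using ncoord_max_attained by blast
  then have "?v \<le> ncoord X \<phi>" by simp
  then have "ncoord X ?T \<le> - ?v"
    using chord_other_end[of X \<phi> ?v] by (simp add: ncoord_le_iff cmod_less_1[OF X(1)])
  then show ?thesis
    using ge[OF X(1)] X unfolding ncoord_min_def
    by (intro cInf_eq_minimum) (auto intro!: ge image_eqI[of _ _ X])
qed

lemma ncoord_max_2pi [simp]: "ncoord_max K (\<phi> + 2 * pi) = ncoord_max K \<phi>"
  and ncoord_min_2pi [simp]: "ncoord_min K (\<phi> + 2 * pi) = ncoord_min K \<phi>"
  by (simp_all add: ncoord_max_def ncoord_min_def)

text \<open>The substitution \<open>T \<phi> = \<phi> + 2 * \<psi>\<^sub>1 \<phi>\<close> exchanges the two families of support lines. It turns the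
  sum of the integrals of the maximum and the minimum into that of \<open>- 2 * cot \<psi>\<^sub>1 * \<psi>\<^sub>1'\<close>, the exact
  derivative of \<open>- 2 * ln (sin \<psi>\<^sub>1) = ln (1 + ncoord_max\<^sup>2)\<close>. As \<open>\<psi>\<^sub>1\<close> need not be differentiable, the
  function \<open>H\<close> below takes its value as a second variable: the total derivative of \<open>H\<close> vanishes, so
  that Lipschitz continuity is enough.\<close>

lemma integral_max_eq_minus_integral_min:
  "integral {0..2 * pi} (ncoord_max K) = - integral {0..2 * pi} (ncoord_min K)"
proof -
  let ?M = "ncoord_max K" and ?m = "ncoord_min K"
  obtain I where I: "\<And>x. (I has_real_derivative ?M x) (at x)"
    using continuous_antiderivative[OF ncoord_max_continuous] by blast
  obtain N where N: "\<And>x. (N has_real_derivative ?m x) (at x)"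
    using continuous_antiderivative[OF ncoord_min_continuous] by blast
  obtain L where L: "\<And>a b. \<bar>?M a - ?M b\<bar> \<le> L * \<bar>a - b\<bar>"
    using ncoord_extrema_lipschitz by metis
  define T where "T = (\<lambda>z::real \<times> real. fst z + pi - 2 * arctan (snd z))"
  define H where "H = (\<lambda>z. N (T z) + I (fst z) - ln (1 + (snd z)\<^sup>2))"
  have H: "(H has_derivative (\<lambda>_. 0)) (at (\<phi>, ?M \<phi>))" for \<phi>
  proof -
    let ?z = "(\<phi>, ?M \<phi>)"
    have q: "1 + (?M \<phi>)\<^sup>2 > 0" using zero_le_power2[of "?M \<phi>"] by linarith
    have fst: "(fst has_derivative fst) (at ?z)" and snd: "(snd has_derivative snd) (at ?z)"
      by (auto intro: bounded_linear_imp_has_derivative bounded_linear_fst bounded_linear_snd)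
    have at: "((\<lambda>z. arctan (snd z)) has_derivative (\<lambda>z. snd z * inverse (1 + (?M \<phi>)\<^sup>2))) (at ?z)"
      using DERIV_compose_FDERIV[OF DERIV_arctan snd] by simp
    have T: "(T has_derivative (\<lambda>z. fst z - 2 * (snd z * inverse (1 + (?M \<phi>)\<^sup>2)))) (at ?z)"
      unfolding T_def by (auto intro!: derivative_eq_intros at)
    have NT: "((\<lambda>z. N (T z)) has_derivative (\<lambda>z. (fst z - 2 * (snd z * inverse (1 + (?M \<phi>)\<^sup>2))) * ?m (T ?z))) (at ?z)"
      by (rule DERIV_compose_FDERIV[OF N T])
    have If: "((\<lambda>z. I (fst z)) has_derivative (\<lambda>z. fst z * ?M \<phi>)) (at ?z)"
      using DERIV_compose_FDERIV[OF I fst] by simp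
    have "((\<lambda>y. ln (1 + y\<^sup>2)) has_real_derivative 2 * ?M \<phi> * inverse (1 + (?M \<phi>)\<^sup>2)) (at (snd ?z))"
      using q by (auto intro!: derivative_eq_intros simp: divide_inverse)
    from DERIV_compose_FDERIV[OF this snd]
    have ln: "((\<lambda>z. ln (1 + (snd z)\<^sup>2)) has_derivative (\<lambda>z. snd z * (2 * ?M \<phi> * inverse (1 + (?M \<phi>)\<^sup>2)))) (at ?z)" .
    \<comment> \<open>This identity makes the coefficients of both variables cancel in the
      derivative of \<open>H\<close>.\<close>
    have mT: "?m (T ?z) = - ?M \<phi>"
      by (simp add: T_def ncoord_min_other_end)
    have eq: "(\<lambda>z. (fst z - 2 * (snd z * inverse (1 + (?M \<phi>)\<^sup>2))) * ?m (T ?z) + fst z * ?M \<phi>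
        - snd z * (2 * ?M \<phi> * inverse (1 + (?M \<phi>)\<^sup>2))) = (\<lambda>_::real \<times> real. 0)"
      unfolding mT by (auto simp: algebra_simps)
    show ?thesis
      using has_derivative_diff[OF has_derivative_add[OF NT If] ln] unfolding eq H_def .
  qed
  define G where "G \<phi> = H (\<phi>, ?M \<phi>)" for \<phi>
  have "(G has_real_derivative 0) (at \<phi>)" for \<phi>
    using has_derivative_zero_along_lipschitz_graph[OF H L, of \<phi>]
    unfolding G_def[abs_def] by (simp add: has_field_derivative_def lambda_zero[symmetric])
  then have "G (2 * pi) = G 0"
    using DERIV_isconst_all by blast
  then have "H (2 * pi, ?M (2 * pi)) = H (0, ?M 0)"
    by (simp add: G_def)
  \<comment> \<open>The second variable returns to its value, so \<open>T\<close> advances by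
    exactly one period and the logarithms cancel.\<close>
  moreover have "?M (2 * pi) = ?M 0" using ncoord_max_2pi[of 0] by simp
  ultimately have eq: "N (T (0, ?M 0) + 2 * pi) - N (T (0, ?M 0)) + (I (2 * pi) - I 0) = 0"
    by (simp add: H_def T_def algebra_simps)
  have "integral {c..c + 2 * pi} ?m = N (c + 2 * pi) - N c" for c
    using N by (intro integral_unique fundamental_theorem_of_calculus)
      (auto simp: has_real_derivative_iff_has_vector_derivative[symmetric] intro: has_field_derivative_at_within)
  moreover have "integral {0..2 * pi} ?M = I (2 * pi) - I 0"
    using I by (intro integral_unique fundamental_theorem_of_calculus)
      (auto simp: has_real_derivative_iff_has_vector_derivative[symmetric] intro: has_field_derivative_at_within)
  moreover have "integral {T (0, ?M 0)..T (0, ?M 0) + 2 * pi} ?m = integral {0..0 + 2 * pi} ?m"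
    by (intro integral_periodic ncoord_min_continuous) auto
  ultimately show ?thesis using eq by simp
qed

end

subsection \<open>Variation along the frontier\<close>

lemma partition_mono:
  fixes t :: "nat \<Rightarrow> real"
  assumes "\<And>i. i < n \<Longrightarrow> t i \<le> t (Suc i)" "i \<le> j" "j \<le> n"
  shows "t i \<le> t j"
  using assms(2,3)
proof (induction j rule: dec_induct)
  case (step k)
  then show ?case using assms(1)[of k] by simp
qed simp

text \<open>A finite form of Banach's indicatrix formula: each partition interval contributes to the number
  of solutions of \<open>f x = v\<close>, which is integrated over \<open>v\<close>.\<close>

lemma variation_le_level_count:
  fixes f :: "real \<Rightarrow> real" and t :: "nat \<Rightarrow> real"
  assumes cont: "continuous_on {0..1} f"
    and t: "t 0 = 0" "t n = 1" "\<And>i. i < n \<Longrightarrow> t i \<le> t (Suc i)"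
    and bounds: "\<And>x. x \<in> {0..1} \<Longrightarrow> m \<le> f x \<and> f x \<le> M"
    and levels: "\<And>v x y z. \<lbrakk>m < v; v < M; {x, y, z} \<subseteq> {0<..<1}; f x = v; f y = v; f z = v\<rbrakk>
                  \<Longrightarrow> x = y \<or> y = z \<or> x = z"
  shows "(\<Sum>i<n. \<bar>f (t i) - f (t (Suc i))\<bar>) \<le> 2 * (M - m)"
proof -
  \<comment> \<open>Open intervals: a solution at a level in \<open>J i\<close> then lies strictly
    between \<open>t i\<close> and \<open>t (Suc i)\<close>, so solutions for different
    \<open>i\<close> are distinct and avoid 0 and 1.\<close>
  define J where "J i = {min (f (t i)) (f (t (Suc i)))<..<max (f (t i)) (f (t (Suc i)))}" for i
  have t01: "t i \<in> {0..1}" if "i \<le> n" for i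
    using partition_mono[of n t 0 i] partition_mono[of n t i n] t that by auto
  have "((\<lambda>v. if v \<in> J i then 1 else 0) has_integral \<bar>f (t i) - f (t (Suc i))\<bar>) {m..M}" if "i < n" for i
  proof -
    let ?c = "min (f (t i)) (f (t (Suc i)))" and ?d = "max (f (t i)) (f (t (Suc i)))"
    have "((\<lambda>_. 1::real) has_integral \<bar>f (t i) - f (t (Suc i))\<bar>) (cbox ?c ?d)"
      using has_integral_const_real[of "1::real" ?c ?d] by (auto simp: min_def max_def split: if_splits)
    moreover have "cbox ?c ?d \<subseteq> cbox m M"
      using bounds[OF t01[of i]] bounds[OF t01[of "Suc i"]] that by (auto simp: min_def max_def)
    ultimately show ?thesis
      unfolding J_def using has_integral_restrict_open_subinterval[of "\<lambda>_. 1::real" _ ?c ?d m M]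
      by simp
  qed
  then have "((\<lambda>v. \<Sum>i<n. if v \<in> J i then 1 else 0) has_integral (\<Sum>i<n. \<bar>f (t i) - f (t (Suc i))\<bar>)) {m..M}"
    by (intro has_integral_sum) auto
  moreover have "m \<le> M" using bounds[of 0] by auto
  then have "((\<lambda>_. 2::real) has_integral 2 * (M - m)) {m..M}"
    using has_integral_const_real[of "2::real" m M] by (simp add: algebra_simps)
  moreover have "(\<Sum>i<n. if v \<in> J i then 1 else 0) \<le> (2::real)" for v
  proof -
    \<comment> \<open>For fixed \<open>v\<close> the sum counts the partition intervals whose end
      values straddle \<open>v\<close>.\<close>
    define S where "S = {i. i < n \<and> v \<in> J i}"
    have "\<exists>x. t i < x \<and> x < t (Suc i) \<and> f x = v" if "i \<in> S" for i
    proof -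
      have i: "i < n" "v \<in> J i" using that by (auto simp: S_def)
      have le: "t i \<le> t (Suc i)" using t(3) i by simp
      have c: "continuous_on {t i..t (Suc i)} f"
        using continuous_on_subset[OF cont] t01[of i] t01[of "Suc i"] i by auto
      have "\<exists>x. t i \<le> x \<and> x \<le> t (Suc i) \<and> f x = v"
      proof (cases "f (t i) \<le> v")
        case True
        then show ?thesis using i(2) le c by (intro IVT') (auto simp: J_def)
      next
        case False
        then show ?thesis using i(2) le c by (intro IVT2') (auto simp: J_def)
      qed
      then obtain x where x: "t i \<le> x" "x \<le> t (Suc i)" "f x = v" by blast
      moreover have "x \<noteq> t i" "x \<noteq> t (Suc i)" using x i(2) by (auto simp: J_def)
      ultimately show ?thesis by (intro exI[of _ x]) auto
    qed
    then obtain x where x: "\<And>i. i \<in> S \<Longrightarrow> t i < x i \<and> x i < t (Suc i) \<and> f (x i) = v" by metis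
    have x01: "x i \<in> {0<..<1}" if "i \<in> S" for i
    proof -
      have "i < n" using that by (simp add: S_def)
      then have "0 \<le> t i" "t (Suc i) \<le> 1" using t01[of i] t01[of "Suc i"] by simp_all
      then show ?thesis using x[OF that] by simp
    qed
    have less: "x i < x j" if "i \<in> S" "j \<in> S" "i < j" for i j
    proof -
      have "t (Suc i) \<le> t j"
        using partition_mono[of n t "Suc i" j] t(3) that by (simp add: S_def)
      then show ?thesis using x[OF that(1)] x[OF that(2)] by linarith
    qed
    have inj: "x i \<noteq> x j" if "i \<in> S" "j \<in> S" "i \<noteq> j" for i j
      using less[OF that(1,2)] less[OF that(2,1)] that(3) by (cases i j rule: linorder_cases) simp_all
    have "card S \<le> 2"
    proof (rule ccontr)
      assume "\<not> card S \<le> 2"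
      then obtain S' where S': "S' \<subseteq> S" "card S' = 3"
        using obtain_subset_with_card_n[of 3 S] by auto
      then obtain i j k where ijk: "S' = {i, j, k}" "i \<noteq> j" "j \<noteq> k" "i \<noteq> k"
        by (auto simp: card_3_iff)
      with S' have S: "i \<in> S" "j \<in> S" "k \<in> S" by auto
      have i: "i < n" "v \<in> J i" using S(1) by (simp_all add: S_def)
      then have "m < v" "v < M"
        using bounds[OF t01[of i]] bounds[OF t01[of "Suc i"]] by (auto simp: J_def)
      moreover have "{x i, x j, x k} \<subseteq> {0<..<1}" using x01 S by blast
      ultimately have "x i = x j \<or> x j = x k \<or> x i = x k"
        using levels[of v "x i" "x j" "x k"] x S by blast
      then show False using inj S ijk by blast
    qed
    moreover have "(\<Sum>i<n. if v \<in> J i then 1 else 0) = real (card S)"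
      by (simp add: S_def sum.If_cases Int_def)
    ultimately show ?thesis by simp
  qed
  ultimately show ?thesis by (rule has_integral_le)
qed

text \<open>The indices \<open>j\<close> and \<open>k\<close> cut the closed cycle into two routes,
  and each has variation at least \<open>\<bar>a j - a k\<bar>\<close>.\<close>

lemma closed_variation_ge:
  fixes a :: "nat \<Rightarrow> real"
  assumes "a 0 = a n" "j \<le> n" "k \<le> n"
  shows "2 * (a j - a k) \<le> (\<Sum>i<n. \<bar>a i - a (Suc i)\<bar>)"
proof -
  have tele: "\<bar>a p - a q\<bar> \<le> (\<Sum>i=p..<q. \<bar>a i - a (Suc i)\<bar>)" if "p \<le> q" for p q
    using sum_abs[of "\<lambda>i. a i - a (Suc i)" "{p..<q}"] that
    by (simp add: sum_Suc_diff'[of p q "\<lambda>i. - a i", simplified])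
  have *: "2 * \<bar>a j - a k\<bar> \<le> (\<Sum>i<n. \<bar>a i - a (Suc i)\<bar>)" if "j \<le> k" "k \<le> n" for j k
  proof -
    \<comment> \<open>The outer pieces join through \<open>a 0 = a n\<close> and form the second
      route.\<close>
    have "2 * \<bar>a j - a k\<bar> \<le> \<bar>a 0 - a j\<bar> + \<bar>a j - a k\<bar> + \<bar>a k - a n\<bar>"
      using assms(1) abs_triangle_ineq[of "a 0 - a j" "a k - a n"] by simp
    also have "\<dots> \<le> (\<Sum>i=0..<j. \<bar>a i - a (Suc i)\<bar>)
        + (\<Sum>i=j..<k. \<bar>a i - a (Suc i)\<bar>) + (\<Sum>i=k..<n. \<bar>a i - a (Suc i)\<bar>)"
      using that by (intro add_mono tele) auto
    also have "\<dots> = (\<Sum>i<n. \<bar>a i - a (Suc i)\<bar>)"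
      using that by (simp add: sum.atLeastLessThan_concat lessThan_atLeast0)
    finally show ?thesis .
  qed
  have "2 * \<bar>a j - a k\<bar> \<le> (\<Sum>i<n. \<bar>a i - a (Suc i)\<bar>)"
  proof (cases "j \<le> k")
    case True
    then show ?thesis using assms(3) by (rule *)
  next
    case False
    then show ?thesis using *[of k j] assms(2) by (simp add: abs_minus_commute)
  qed
  then show ?thesis
    by (rule order_trans[rotated]) (rule mult_left_mono[OF abs_ge_self], simp)
qed

text \<open>A point strictly between the interior point \<open>p\<close> and a frontier point is
  interior, so each ray from \<open>p\<close> carries at most one frontier point. Of three nonzero
  parameters two have the same sign.\<close>

lemma convex_line_meets_frontier_twice:
  fixes K :: "complex set"
  assumes K: "convex K" "closed K" and p: "p \<in> interior K"
    and X: "p + of_real a * W \<in> frontier K" "p + of_real b * W \<in> frontier K" "p + of_real c * W \<in> frontier K"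
  shows "a = b \<or> b = c \<or> a = c"
proof -
  have less: False if "p + of_real x * W \<in> frontier K" "p + of_real y * W \<in> frontier K" "0 < x / y" "x / y < 1" for x y
  proof -
    have "y \<noteq> 0" using that by auto
    have "p \<noteq> p + of_real y * W" using that(2) p by (auto simp: frontier_def)
    moreover have "p + of_real x * W = (1 - x / y) *\<^sub>R p + (x / y) *\<^sub>R (p + of_real y * W)"
      using \<open>y \<noteq> 0\<close> by (simp add: algebra_simps scaleR_conv_of_real)
    ultimately have "p + of_real x * W \<in> open_segment p (p + of_real y * W)"
      unfolding in_segment using that by blast
    moreover have "p + of_real y * W \<in> closure K" using that(2) by (auto simp: frontier_def)
    ultimately have "p + of_real x * W \<in> interior K"
      using in_interior_closure_convex_segment[OF K(1) p] by blast
    then show False using that(1) by (auto simp: frontier_def)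
  qed
  have same: "x = y" if "p + of_real x * W \<in> frontier K" "p + of_real y * W \<in> frontier K" "0 < x * y" for x y
  proof (rule ccontr)
    assume "x \<noteq> y"
    have pos: "0 < x / y" "0 < y / x"
      using that(3) by (auto simp: zero_less_mult_iff zero_less_divide_iff)
    have "x / y \<noteq> 1" using pos \<open>x \<noteq> y\<close> by auto
    moreover have "inverse (x / y) = y / x" by simp
    ultimately have "x / y < 1 \<or> y / x < 1"
      using inverse_less_1_iff[of "x / y"] by linarith
    then show False
      using pos less[OF that(1,2)] less[OF that(2,1)] by argo
  qed
  have "x \<noteq> 0" if "p + of_real x * W \<in> frontier K" for x
    using that p by (auto simp: frontier_def)
  then have "a \<noteq> 0" "b \<noteq> 0" "c \<noteq> 0" using X by auto
  then have "0 < a * b \<or> 0 < b * c \<or> 0 < a * c"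
    by (auto simp: zero_less_mult_iff)
  then show ?thesis using same[OF X(1,2)] same[OF X(2,3)] same[OF X(1,3)] by argo
qed

section \<open>Level lines and the frontier of a convex body\<close>

locale klein_convex_body = klein_compact +
  assumes K_convex: "convex K" and K_interior: "interior K \<noteq> {}"
begin

lemma frontier_in_K: "frontier K \<subseteq> K"
  using K_compact by (simp add: compact_imp_closed frontier_subset_closed)

text \<open>The affine form \<open>g\<close> takes both signs on \<open>K\<close>. An interior point
  \<open>q\<close> off the level is joined to a point of \<open>K\<close> on the other side; the
  crossing lies strictly inside the segment and is therefore interior.\<close>

lemma interior_point_on_level:
  assumes "ncoord_min K \<phi> < v" "v < ncoord_max K \<phi>"
  obtains p where "p \<in> interior K" "ncoord p \<phi> = v"
proof -
  define g where "g X = chord_num X \<phi> - v * chord_den X \<phi>" for X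
  have g: "g ((1 - s) *\<^sub>R X + s *\<^sub>R Y) = (1 - s) * g X + s * g Y" for s X Y
    unfolding g_def chord_num_def chord_den_def by (simp add: algebra_simps)
  have g_iff: "g X \<le> 0 \<longleftrightarrow> ncoord X \<phi> \<le> v" "0 \<le> g X \<longleftrightarrow> v \<le> ncoord X \<phi>" if "X \<in> K" for X
    unfolding g_def using ncoord_le_iff cmod_less_1[OF that] by blast+
  obtain X where X: "X \<in> K" "g X < 0"
    using ncoord_min_attained[of \<phi>] g_iff(2) assms(1) by (metis not_less)
  obtain Y where Y: "Y \<in> K" "0 < g Y"
    using ncoord_max_attained[of \<phi>] g_iff(1) assms(2) by (metis not_less)
  obtain q where q: "q \<in> interior K" using K_interior by blast
  have "\<exists>p \<in> interior K. g p = 0"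
  proof (cases "g q = 0")
    case False
    then obtain Z where Z: "Z \<in> K" "g q * g Z < 0"
      using X Y by (metis linorder_neqE_linordered_idom mult_pos_neg mult_neg_pos)
    \<comment> \<open>The zero of the linear interpolation between \<open>g q\<close> and
      \<open>g Z\<close>.\<close>
    define s where "s = g q / (g q - g Z)"
    have "g q - g Z \<noteq> 0" using Z(2) by auto
    then have "g ((1 - s) *\<^sub>R q + s *\<^sub>R Z) = 0"
      unfolding g s_def by (simp add: field_simps)
    moreover have "0 < s" "s < 1"
      using Z(2) unfolding s_def by (auto simp: mult_less_0_iff zero_less_divide_iff divide_less_eq)
    moreover have "q \<noteq> Z" using Z(2) by auto
    ultimately have "(1 - s) *\<^sub>R q + s *\<^sub>R Z \<in> open_segment q Z"
      unfolding in_segment by blast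
    then have "(1 - s) *\<^sub>R q + s *\<^sub>R Z \<in> interior K"
      using in_interior_closure_convex_segment[OF K_convex q] Z(1) closure_subset by blast
    with \<open>g _ = 0\<close> show ?thesis by blast
  qed (use q in blast)
  then obtain p where p: "p \<in> interior K" "g p = 0" by blast
  then have "p \<in> K" using interior_subset by blast
  then show ?thesis using that[OF p(1)] g_iff[of p] p(2) by simp
qed

text \<open>The level points lie on one line, parametrised from an interior point on it, so the
  count of frontier points on such a line applies.\<close>

lemma frontier_points_on_level:
  assumes "ncoord_min K \<phi> < v" "v < ncoord_max K \<phi>"
    and "{X, Y, Z} \<subseteq> frontier K" "ncoord X \<phi> = v" "ncoord Y \<phi> = v" "ncoord Z \<phi> = v"
  shows "X = Y \<or> Y = Z \<or> X = Z"
proof -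
  obtain p where p: "p \<in> interior K" "ncoord p \<phi> = v"
    using interior_point_on_level[OF assms(1,2)] .
  \<comment> \<open>Rotated by \<open>cis (- \<phi>)\<close>, the level condition reads
    \<open>Im = v * (1 - Re)\<close>, a line with direction \<open>Complex 1 (- v)\<close>.\<close>
  define W where "W = Complex 1 (- v) * cis \<phi>"
  define c where "c U = Re ((U - p) * cis (- \<phi>))" for U
  have line: "U = p + of_real (c U) * W" if "U \<in> K" "ncoord U \<phi> = v" for U
  proof -
    have "chord_num U \<phi> = v * chord_den U \<phi>" "chord_num p \<phi> = v * chord_den p \<phi>"
      using that p interior_subset chord_den_pos[OF cmod_less_1, of _ \<phi>]
      by (force simp: ncoord_def field_simps)+
    then have "chord_num (U - p) \<phi> = v * (chord_den (U - p) \<phi> - 1)"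
      by (simp add: chord_num_diff chord_den_diff algebra_simps)
    then have "(U - p) * cis (- \<phi>) = of_real (c U) * Complex 1 (- v)"
      unfolding chord_num_eq_Im chord_den_eq_Re c_def complex_eq_iff by (simp add: algebra_simps)
    then have "(U - p) * cis (- \<phi>) * cis \<phi> = of_real (c U) * W"
      unfolding W_def by (simp add: mult.assoc)
    then show ?thesis by (simp add: mult.assoc cis_mult algebra_simps)
  qed
  have "c X = c Y \<or> c Y = c Z \<or> c X = c Z"
    using K_convex compact_imp_closed[OF K_compact] p(1)
    by (rule convex_line_meets_frontier_twice[where W = W])
       (use assms frontier_in_K line in \<open>force+\<close>)
  then show ?thesis using line assms frontier_in_K by (metis insert_subset subset_iff)
qed

text \<open>Moving along \<open>evec \<phi>\<close> keeps the denominator fixed and changes the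
  numerator linearly, so an interior point has points of \<open>K\<close> with strictly larger and
  strictly smaller coordinate nearby.\<close>

lemma ncoord_extremum_in_frontier:
  assumes "X \<in> K" "ncoord X \<phi> = ncoord_max K \<phi> \<or> ncoord X \<phi> = ncoord_min K \<phi>"
  shows "X \<in> frontier K"
proof (rule ccontr)
  assume "X \<notin> frontier K"
  then have "X \<in> interior K"
    using assms(1) closure_subset by (auto simp: frontier_def)
  then obtain e where e: "e > 0" "cball X e \<subseteq> K"
    using mem_interior_cball by blast
  have shift: "ncoord (X + of_real s * (\<i> * cis \<phi>)) \<phi> = ncoord X \<phi> + s / chord_den X \<phi>" for s
  proof -
    have "Re (X + of_real s * (\<i> * cis \<phi>)) = Re X - s * sin \<phi>"
      "Im (X + of_real s * (\<i> * cis \<phi>)) = Im X + s * cos \<phi>"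
      by simp_all
    then have "chord_num (X + of_real s * (\<i> * cis \<phi>)) \<phi> = chord_num X \<phi> + s"
      unfolding chord_num_def using sin_cos_squared_add[of \<phi>] by algebra
    moreover have "chord_den (X + of_real s * (\<i> * cis \<phi>)) \<phi> = chord_den X \<phi>"
      unfolding chord_den_def by (simp add: algebra_simps)
    ultimately show ?thesis by (simp add: ncoord_def add_divide_distrib)
  qed
  have "X + of_real s * (\<i> * cis \<phi>) \<in> K" if "\<bar>s\<bar> \<le> e" for s
    using that e by (intro subsetD[OF e(2)]) (simp add: dist_norm norm_mult)
  then have "X + of_real e * (\<i> * cis \<phi>) \<in> K" "X + of_real (- e) * (\<i> * cis \<phi>) \<in> K"
    using e(1) by (simp_all only: abs_minus_cancel abs_of_pos order.refl)
  then have "ncoord X \<phi> + e / chord_den X \<phi> \<le> ncoord_max K \<phi>" "ncoord_min K \<phi> \<le> ncoord X \<phi> + - e / chord_den X \<phi>"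
    using ncoord_le_max min_le_ncoord shift by metis+
  moreover have "0 < e / chord_den X \<phi>"
    using e(1) chord_den_pos[OF cmod_less_1[OF assms(1)]] by simp
  ultimately show False
    using assms(2) ncoord_le_max[OF assms(1), of \<phi>] min_le_ncoord[OF assms(1), of \<phi>] by auto
qed

end

subsection \<open>Inscribed polygons\<close>

locale klein_convex_curve = klein_convex_body +
  fixes \<gamma> :: "real \<Rightarrow> complex"
  assumes \<gamma>_simple: "simple_path \<gamma>" and \<gamma>_closed: "pathfinish \<gamma> = pathstart \<gamma>"
    and \<gamma>_image: "path_image \<gamma> = frontier K"
begin

lemma \<gamma>_frontier: "s \<in> {0..1} \<Longrightarrow> \<gamma> s \<in> frontier K"
  using \<gamma>_image by (auto simp: path_image_def)

lemma \<gamma>_in_K: "s \<in> {0..1} \<Longrightarrow> \<gamma> s \<in> K"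
  using \<gamma>_frontier frontier_in_K by blast

lemma \<gamma>_continuous: "continuous_on {0..1} \<gamma>"
  using \<gamma>_simple by (simp add: simple_path_def path_def)

text \<open>The open interval is used because a loop takes equal values at 0 and 1.\<close>

lemma \<gamma>_inj: "\<lbrakk>x \<in> {0<..<1}; y \<in> {0<..<1}; \<gamma> x = \<gamma> y\<rbrakk> \<Longrightarrow> x = y"
  using \<gamma>_simple by (force simp: simple_path_def loop_free_def)

lemma ncoord_\<gamma>_continuous: "continuous_on {0..1} (\<lambda>s. ncoord (\<gamma> s) \<phi>)"
  by (rule continuous_on_compose2[OF ncoord_continuous_point \<gamma>_continuous]) (auto intro: \<gamma>_in_K)

lemma inscribed_polygon_crofton:
  assumes "\<And>i. i \<le> n \<Longrightarrow> t i \<in> {0..1}"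
  shows "((\<lambda>\<phi>. \<Sum>i<n. \<bar>ncoord (\<gamma> (t i)) \<phi> - ncoord (\<gamma> (t (Suc i))) \<phi>\<bar>) has_integral
    4 * (\<Sum>i<n. hdist (\<gamma> (t i)) (\<gamma> (t (Suc i))))) {0..2 * pi}"
  unfolding sum_distrib_left
  by (intro has_integral_sum hdist_crofton cmod_less_1 \<gamma>_in_K assms) auto

text \<open>The minimum integrates to the negative of the maximum; the resulting factor 4 matches
  the one in Crofton's formula.\<close>

lemma width_has_integral:
  "((\<lambda>\<phi>. 2 * (ncoord_max K \<phi> - ncoord_min K \<phi>)) has_integral 4 * integral {0..2 * pi} (ncoord_max K)) {0..2 * pi}"
proof -
  let ?I = "integral {0..2 * pi} (ncoord_max K)"
  have "(ncoord_max K has_integral ?I) {0..2 * pi}"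
    by (intro integrable_integral integrable_continuous_interval ncoord_max_continuous)
  moreover have "(ncoord_min K has_integral - ?I) {0..2 * pi}"
    unfolding integral_max_eq_minus_integral_min minus_minus
    by (intro integrable_integral integrable_continuous_interval ncoord_min_continuous)
  ultimately show ?thesis
    using has_integral_mult_right[OF has_integral_diff, of "ncoord_max K" ?I "{0..2 * pi}" "ncoord_min K" "- ?I" 2]
    by simp
qed

text \<open>At each angle the level count bounds the variation by twice the width; integrating over
  the angle compares polygon and integral.\<close>

lemma inscribed_polygon_le:
  assumes t: "t 0 = 0" "t n = 1" "\<And>i. i < n \<Longrightarrow> t i \<le> t (Suc i)"
  shows "(\<Sum>i<n. hdist (\<gamma> (t i)) (\<gamma> (t (Suc i)))) \<le> integral {0..2 * pi} (ncoord_max K)"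
proof -
  have "t i \<in> {0..1}" if "i \<le> n" for i
    using partition_mono[of n t 0 i] partition_mono[of n t i n] t that by simp
  note int = inscribed_polygon_crofton[of n t, OF this]
  have "(\<Sum>i<n. \<bar>ncoord (\<gamma> (t i)) \<phi> - ncoord (\<gamma> (t (Suc i))) \<phi>\<bar>)
      \<le> 2 * (ncoord_max K \<phi> - ncoord_min K \<phi>)" for \<phi>
  proof (rule variation_le_level_count[where f = "\<lambda>s. ncoord (\<gamma> s) \<phi>", OF ncoord_\<gamma>_continuous t])
    show "ncoord_min K \<phi> \<le> ncoord (\<gamma> x) \<phi> \<and> ncoord (\<gamma> x) \<phi> \<le> ncoord_max K \<phi>" if "x \<in> {0..1}" for x
      using ncoord_le_max min_le_ncoord \<gamma>_in_K[OF that] by blast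
    fix v x y z
    assume v: "ncoord_min K \<phi> < v" "v < ncoord_max K \<phi>" and xyz: "{x, y, z} \<subseteq> {0<..<1}"
      and lev: "ncoord (\<gamma> x) \<phi> = v" "ncoord (\<gamma> y) \<phi> = v" "ncoord (\<gamma> z) \<phi> = v"
    have "{\<gamma> x, \<gamma> y, \<gamma> z} \<subseteq> frontier K" using xyz by (auto intro: \<gamma>_frontier)
    from frontier_points_on_level[OF v this lev] show "x = y \<or> y = z \<or> x = z"
      using xyz \<gamma>_inj by auto
  qed
  then have "4 * (\<Sum>i<n. hdist (\<gamma> (t i)) (\<gamma> (t (Suc i)))) \<le> 4 * integral {0..2 * pi} (ncoord_max K)"
    by (intro has_integral_le[OF int width_has_integral])
  then show ?thesis by simp
qed

text \<open>Extremal points lie on the curve, and a fine partition has vertices near both. The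
  Lipschitz constant is uniform in \<phi>, so one partition serves all angles.\<close>

lemma inscribed_polygon_ge:
  assumes "e > 0"
  shows "\<exists>n t. t 0 = 0 \<and> t n = 1 \<and> (\<forall>i<n. t i \<le> t (Suc i)) \<and>
    integral {0..2 * pi} (ncoord_max K) - 2 * pi * e \<le> (\<Sum>i<n. hdist (\<gamma> (t i)) (\<gamma> (t (Suc i))))"
proof -
  obtain L where L: "L > 0"
    "\<And>X Y \<phi>. X \<in> K \<Longrightarrow> Y \<in> K \<Longrightarrow> \<bar>ncoord X \<phi> - ncoord Y \<phi>\<bar> \<le> L * cmod (X - Y)"
    using ncoord_lipschitz by metis
  have "e / L > 0" using assms L by simp
  then obtain d where d: "d > 0"
    "\<And>s s'. \<lbrakk>s \<in> {0..1}; s' \<in> {0..1}; dist s' s < d\<rbrakk> \<Longrightarrow> dist (\<gamma> s') (\<gamma> s) < e / L"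
    using compact_uniformly_continuous[OF \<gamma>_continuous] unfolding uniformly_continuous_on_def
    by (metis compact_Icc)
  obtain m where m: "inverse (real (Suc m)) < d" using reals_Archimedean[OF d(1)] by blast
  define n where "n = Suc m"
  define t where "t i = real i / real n" for i :: nat
  have n: "n > 0" "1 / real n < d" using m by (simp_all add: n_def inverse_eq_divide)
  have t: "t 0 = 0" "t n = 1" "\<And>i. t i \<le> t (Suc i)"
    using n by (auto simp: t_def divide_right_mono)
  have t01: "t i \<in> {0..1}" if "i \<le> n" for i using that n by (simp add: t_def)
  have near: "\<exists>j\<le>n. \<forall>\<phi>. \<bar>ncoord (\<gamma> (t j)) \<phi> - ncoord (\<gamma> s) \<phi>\<bar> \<le> e" if s: "s \<in> {0..1}" for s
  proof -
    \<comment> \<open>The last node not beyond \<open>s\<close>; for \<open>s = 1\<close> this is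
      node \<open>n\<close> itself.\<close>
    define j where "j = nat \<lfloor>real n * s\<rfloor>"
    have "0 \<le> real n * s" using s by simp
    then have j: "real j \<le> real n * s" "real n * s < real j + 1"
      unfolding j_def by linarith+
    have "real n * s \<le> real n" using s n by (simp add: mult_left_le)
    then have "j \<le> n" using j(1) by linarith
    moreover have "t j \<le> s" "s < t j + 1 / real n"
      using j n by (simp_all add: t_def field_simps)
    then have "dist (t j) s < d" using n(2) by (simp add: dist_real_def)
    then have "cmod (\<gamma> (t j) - \<gamma> s) < e / L"
      using d(2)[OF s t01[OF \<open>j \<le> n\<close>]] by (simp add: dist_norm)
    then have "L * cmod (\<gamma> (t j) - \<gamma> s) \<le> e" using L(1) by (simp add: field_simps)
    then have "\<bar>ncoord (\<gamma> (t j)) \<phi> - ncoord (\<gamma> s) \<phi>\<bar> \<le> e" for \<phi>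
      using L(2)[OF \<gamma>_in_K[OF t01[OF \<open>j \<le> n\<close>]] \<gamma>_in_K[OF s], of \<phi>] by linarith
    ultimately show ?thesis by blast
  qed
  have "2 * (ncoord_max K \<phi> - ncoord_min K \<phi>) - 4 * e
      \<le> (\<Sum>i<n. \<bar>ncoord (\<gamma> (t i)) \<phi> - ncoord (\<gamma> (t (Suc i))) \<phi>\<bar>)" for \<phi>
  proof -
    have "\<exists>s\<in>{0..1}. \<gamma> s = X" if "X \<in> frontier K" for X
      using that unfolding \<gamma>_image[symmetric] path_image_def by blast
    then obtain s s' where s: "s \<in> {0..1}" "ncoord (\<gamma> s) \<phi> = ncoord_max K \<phi>"
      and s': "s' \<in> {0..1}" "ncoord (\<gamma> s') \<phi> = ncoord_min K \<phi>"
      using ncoord_max_attained[of \<phi>] ncoord_min_attained[of \<phi>] ncoord_extremum_in_frontier by metis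
    obtain j where j: "j \<le> n" "\<bar>ncoord (\<gamma> (t j)) \<phi> - ncoord_max K \<phi>\<bar> \<le> e"
      using near[OF s(1)] s(2) by metis
    obtain k where k: "k \<le> n" "\<bar>ncoord (\<gamma> (t k)) \<phi> - ncoord_min K \<phi>\<bar> \<le> e"
      using near[OF s'(1)] s'(2) by metis
    have "\<gamma> (t 0) = \<gamma> (t n)"
      using \<gamma>_closed by (simp add: t pathfinish_def pathstart_def)
    then have "2 * (ncoord (\<gamma> (t j)) \<phi> - ncoord (\<gamma> (t k)) \<phi>)
        \<le> (\<Sum>i<n. \<bar>ncoord (\<gamma> (t i)) \<phi> - ncoord (\<gamma> (t (Suc i))) \<phi>\<bar>)"
      using closed_variation_ge[of "\<lambda>i. ncoord (\<gamma> (t i)) \<phi>" n j k] j k by simp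
    \<comment> \<open>An error \<open>e\<close> at each of the two vertices, doubled, costs
      \<open>4 * e\<close>; integrated over the circle and divided by 4 it becomes
      \<open>2 * pi * e\<close>.\<close>
    moreover have "2 * (ncoord_max K \<phi> - ncoord_min K \<phi>) - 4 * e \<le> 2 * (ncoord (\<gamma> (t j)) \<phi> - ncoord (\<gamma> (t k)) \<phi>)"
      using j(2) k(2) by argo
    ultimately show ?thesis by (rule order_trans[rotated])
  qed
  moreover have "((\<lambda>\<phi>. 2 * (ncoord_max K \<phi> - ncoord_min K \<phi>) - 4 * e) has_integral
      4 * integral {0..2 * pi} (ncoord_max K) - 4 * e * (2 * pi)) {0..2 * pi}"
    using has_integral_diff[OF width_has_integral has_integral_const_real[of "4 * e" 0 "2 * pi"]]
    by (simp add: mult.commute)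
  ultimately have "4 * integral {0..2 * pi} (ncoord_max K) - 4 * e * (2 * pi)
      \<le> 4 * (\<Sum>i<n. hdist (\<gamma> (t i)) (\<gamma> (t (Suc i))))"
    by (intro has_integral_le[OF _ inscribed_polygon_crofton[of n t, OF t01]])
  then have "integral {0..2 * pi} (ncoord_max K) - 2 * pi * e \<le> (\<Sum>i<n. hdist (\<gamma> (t i)) (\<gamma> (t (Suc i))))"
    by argo
  then show ?thesis
    using t by blast
qed

lemma hlength_eq_integral: "hlength \<gamma> = integral {0..2 * pi} (ncoord_max K)"
  unfolding hlength_def
proof (rule cSup_eq_non_empty)
  let ?S = "{\<Sum>i<n. hdist (\<gamma> (t i)) (\<gamma> (t (Suc i))) |n t. t 0 = 0 \<and> t n = 1 \<and> (\<forall>i<n. t i \<le> t (Suc i))}"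
  show "?S \<noteq> {}"
    using inscribed_polygon_ge[OF zero_less_one] by blast
  show "x \<le> integral {0..2 * pi} (ncoord_max K)" if "x \<in> ?S" for x
    using that inscribed_polygon_le by blast
  show "integral {0..2 * pi} (ncoord_max K) \<le> y" if y: "\<And>x. x \<in> ?S \<Longrightarrow> x \<le> y" for y
  proof (rule field_le_epsilon)
    fix e :: real assume "e > 0"
    \<comment> \<open>With this choice the deficit \<open>2 * pi * e\<close> of
      \<open>inscribed_polygon_ge\<close> equals the given margin.\<close>
    then have "e / (2 * pi) > 0" by simp
    from inscribed_polygon_ge[OF this] obtain n t where
      "t 0 = 0 \<and> t n = 1 \<and> (\<forall>i<n. t i \<le> t (Suc i))"
      and ge: "integral {0..2 * pi} (ncoord_max K) - 2 * pi * (e / (2 * pi))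
        \<le> (\<Sum>i<n. hdist (\<gamma> (t i)) (\<gamma> (t (Suc i))))" by blast
    then have "(\<Sum>i<n. hdist (\<gamma> (t i)) (\<gamma> (t (Suc i)))) \<le> y"
      by (intro y) blast
    then show "integral {0..2 * pi} (ncoord_max K) \<le> y + e" using ge by simp
  qed
qed

end

theorem theorem4p2:
  fixes K :: "complex set" and \<gamma> :: "real \<Rightarrow> complex"
  assumes "K \<subseteq> kleinD" and "compact K" and "convex K" and "interior K \<noteq> {}"
    and "simple_path \<gamma>" and "pathfinish \<gamma> = pathstart \<gamma>"
    and "path_image \<gamma> = frontier K"
  shows "(supp_h K has_integral hlength \<gamma>) {0..2*pi}"
proof -
  interpret klein_convex_curve K \<gamma>
    using assms by unfold_locales auto
  show ?thesis
    unfolding supp_h_eq_ncoord_max hlength_eq_integral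
    by (intro integrable_integral integrable_continuous_interval ncoord_max_continuous)
qed

end
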